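(* Let $N=1$, $\gamma\in(0,2)$, $\theta_0\in[0,1]$, $M>1$, and let $C_1,C_2,C_3>0$ be constants. Let $c(z)dz$ be a positive Radon measure on $\mathbf{R}^N\setminus\{0\}$ such that $$\int_{\mathbf{R}^N}\min(|z|^2,1)\,c(z)dz\le C_1,\qquad \frac{C_2}{|z|^{N+\gamma}}\le |c(z)|\le \frac{C_3}{|z|^{N+\gamma}}\quad\text{for all } 0<|z|\le 1 .$$ Let $g:\mathbf{R}^N\to\mathbf{R}$ satisfy $|g(x)-g(y)|\le M|x-y|^{\theta_0}$ for all $x,y\in\mathbf{R}^N$. Let $F:\mathbf{R}^N\times\mathbf{R}^N\times\mathbf{S}^N\to\mathbf{R}$ be continuous and satisfy: (degenerate ellipticity) $F(x,p,X)\ge F(x,p,Y)$ whenever $X\le Y$, for all $x,p\in\mathbf{R}^N$, $X,Y\in\mathbf{S}^N$; (continuity) there are $q\ge 1$ and functions $w,\eta:[0,\infty)\to[0,\infty)$ with $\lim_{\sigma\downarrow0}w(\sigma)=\lim_{\sigma\downarrow0}\eta(\sigma)=0$ such that $$|F(x,p,X)-F(y,p,X)|\le w(|x-y|)|p|^q+\eta(|x-y|)\|X\|\quad\text{for all } x,y,p\in\mathbf{R}^N,\ X\in\mathbf{S}^N.$$ Assume that there exist constants $L>0$ and $\rho_1,\rho_2>0$ such that $$\lim_{s\downarrow0}w(s)s^{-\rho_1}\le L,\qquad \lim_{s\downarrow0}\eta(s)s^{-\rho_2}\le L,$$ with $\rho_1+\gamma>q$ and $\rho_2+\gamma>2$.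 Let $v$ be a viscosity solution of $$F(x,\nabla v(x),\nabla^2v(x))-\int_{\mathbf{R}^N}\big[v(x+z)-v(x)-\mathbf{1}_{|z|\le1}\langle\nabla v(x),z\rangle\big]c(z)dz-g(x)=0,\qquad x\in\mathbf{R}^N,$$ satisfying $\sup_{x\in\mathbf{R}^N}|v(x)|<M$. Then for any $\theta\in(0,\min\{1,\theta_0+\gamma\})$ there exists a constant $C_\theta>0$ such that $$|v(x)-v(y)|\le C_\theta|x-y|^\theta\qquad\text{for all }x,y\in\mathbf{R}^N.$$ The constant $C_\theta$ depends only on $M$ and $C_i$ ($1\le i\le3$).
   Context: $\mathbf{S}^N$ is the set of real symmetric $N\times N$ matrices with its usual order; $I$ is the identity matrix. For $u$ upper semicontinuous (resp. lower semicontinuous), $J^{2,+}_{\mathbf{R}^N}u(\hat x)$ (resp. $J^{2,-}_{\mathbf{R}^N}u(\hat x)$) is the second-order superjet (resp. subjet): the set of $(p,X)\in\mathbf{R}^N\times\mathbf{S}^N$ with $u(\hat x+z)\le$ (resp. $\ge$) $u(\hat x)+\langle p,z\rangle+\frac12\langle Xz,z\rangle+o(|z|^2)$ as $z\to0$. Hence for every $\delta>0$ there is $\varepsilon>0$ such that (A) $u(\hat x+z)\le u(\hat x)+\langle p,z\rangle+\frac12\langle Xz,z\rangle+\delta|z|^2$ for $|z|\le\varepsilon$ (resp. (B) $u(\hat x+z)\ge u(\hat x)+\langle p,z\rangle+\frac12\langle Xz,z\rangle-\delta|z|^2$ for $|z|\le\varepsilon$). Definition of viscosity solution. An upper semicontinuous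 $u$ is a viscosity subsolution of the equation if for any $\hat x$, any $(p,X)\in J^{2,+}_{\mathbf{R}^N}u(\hat x)$, any pair of positive numbers $(\varepsilon,\delta)$ satisfying (A), and any $0<\varepsilon'\le\varepsilon$, $$F(\hat x,p,X)-\int_{|z|<\varepsilon'}\tfrac12\langle(X+2\delta I)z,z\rangle c(z)dz-\int_{|z|\ge\varepsilon'}[u(\hat x+z)-u(\hat x)-\mathbf{1}_{|z|\le1}\langle z,p\rangle]c(z)dz-g(\hat x)\le0.$$ A lower semicontinuous $u$ is a viscosity supersolution if for any $\hat x$, any $(p,X)\in J^{2,-}_{\mathbf{R}^N}u(\hat x)$, any pair $(\varepsilon,\delta)$ satisfying (B), and any $0<\varepsilon'\le\varepsilon$, $$F(\hat x,p,X)-\int_{|z|<\varepsilon'}\tfrac12\langle(X-2\delta I)z,z\rangle c(z)dz-\int_{|z|\ge\varepsilon'}[u(\hat x+z)-u(\hat x)-\mathbf{1}_{|z|\le1}\langle z,p\rangle]c(z)dz-g(\hat x)\ge0.$$ A viscosity solution is a function that is both a viscosity subsolution and a viscosity supersolution.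
   Formalization: The constant C_θ may depend, besides M and C_i, on γ, θ₀, θ and the data q, w, η, L, ρ₁, ρ₂ of F's continuity condition (it is uniform in c, g, F, v otherwise); independence of w fails, e.g. for F = −K clip(x)p as K→∞. *)

theory Defs
  imports "HOL-Analysis.Analysis" "HOL-Library.Landau_Symbols"
begin

(* Everything below is in space dimension N = 1: points and gradients are real numbers, and a
   symmetric 1 x 1 matrix is its single entry X, so that the matrix order is the order of the
   reals, the quadratic form <Xz,z> is X * z^2, the norm is the absolute value, and the identity
   matrix is 1. *)

definition upper_semicontinuous :: "(real \<Rightarrow> real) \<Rightarrow> bool" where
  "upper_semicontinuous u \<longleftrightarrow> (\<forall>x. \<forall>a > u x. \<forall>\<^sub>F y in nhds x. u y < a)"

definition lower_semicontinuous :: "(real \<Rightarrow> real) \<Rightarrow> bool" where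
  "lower_semicontinuous u \<longleftrightarrow> (\<forall>x. \<forall>a < u x. \<forall>\<^sub>F y in nhds x. a < u y)"

definition superjet :: "(real \<Rightarrow> real) \<Rightarrow> real \<Rightarrow> (real \<times> real) set" where
  "superjet u x = {(p, X). \<exists>r \<in> o[at 0](\<lambda>z. \<bar>z\<bar>\<^sup>2). \<forall>\<^sub>F z in at 0.
     u (x + z) \<le> u x + p * z + 1/2 * (X * z\<^sup>2) + r z}"

definition subjet :: "(real \<Rightarrow> real) \<Rightarrow> real \<Rightarrow> (real \<times> real) set" where
  "subjet u x = {(p, X). \<exists>r \<in> o[at 0](\<lambda>z. \<bar>z\<bar>\<^sup>2). \<forall>\<^sub>F z in at 0.
     u (x + z) \<ge> u x + p * z + 1/2 * (X * z\<^sup>2) + r z}"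

definition upper_bound_pair ::
    "(real \<Rightarrow> real) \<Rightarrow> real \<Rightarrow> real \<Rightarrow> real \<Rightarrow> real \<Rightarrow> real \<Rightarrow> bool" where
  "upper_bound_pair u x p X \<epsilon> \<delta> \<longleftrightarrow> \<epsilon> > 0 \<and> \<delta> > 0 \<and>
     (\<forall>z. \<bar>z\<bar> \<le> \<epsilon> \<longrightarrow> u (x + z) \<le> u x + p * z + 1/2 * (X * z\<^sup>2) + \<delta> * \<bar>z\<bar>\<^sup>2)"

definition lower_bound_pair ::
    "(real \<Rightarrow> real) \<Rightarrow> real \<Rightarrow> real \<Rightarrow> real \<Rightarrow> real \<Rightarrow> real \<Rightarrow> bool" where
  "lower_bound_pair u x p X \<epsilon> \<delta> \<longleftrightarrow> \<epsilon> > 0 \<and> \<delta> > 0 \<and>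
     (\<forall>z. \<bar>z\<bar> \<le> \<epsilon> \<longrightarrow> u (x + z) \<ge> u x + p * z + 1/2 * (X * z\<^sup>2) - \<delta> * \<bar>z\<bar>\<^sup>2)"

(* The jump measure lives on the reals without 0. It is given by its density c with respect to
   Lebesgue measure; the value of c at 0 is irrelevant, {0} being a null set. *)
definition positive_radon_density :: "(real \<Rightarrow> real) \<Rightarrow> bool" where
  "positive_radon_density c \<longleftrightarrow> c \<in> borel_measurable lebesgue \<and> (\<forall>z. z \<noteq> 0 \<longrightarrow> 0 \<le> c z) \<and>
     (\<forall>K. compact K \<and> 0 \<notin> K \<longrightarrow> (\<integral>\<^sup>+z\<in>K. ennreal (c z) \<partial>lebesgue) < \<infinity>)"

definition near_integral :: "(real \<Rightarrow> real) \<Rightarrow> real \<Rightarrow> real \<Rightarrow> real" where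
  "near_integral c Y \<epsilon> = (LINT z:{z. \<bar>z\<bar> < \<epsilon>}|lebesgue. 1/2 * (Y * z\<^sup>2) * c z)"

(* Both integrals converge whenever u is bounded and measurable and min(z^2,1) is integrable
   against c(z)dz, so the convention that a divergent integral is 0 plays no role for the bounded
   solutions considered here. *)
definition far_integral ::
    "(real \<Rightarrow> real) \<Rightarrow> (real \<Rightarrow> real) \<Rightarrow> real \<Rightarrow> real \<Rightarrow> real \<Rightarrow> real" where
  "far_integral c u x p \<epsilon> =
     (LINT z:{z. \<epsilon> \<le> \<bar>z\<bar>}|lebesgue. (u (x + z) - u x - of_bool (\<bar>z\<bar> \<le> 1) * (z * p)) * c z)"

definition viscosity_subsolution ::
    "(real \<Rightarrow> real \<Rightarrow> real \<Rightarrow> real) \<Rightarrow> (real \<Rightarrow> real) \<Rightarrow> (real \<Rightarrow> real) \<Rightarrow> (real \<Rightarrow> real) \<Rightarrow> bool" where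
  "viscosity_subsolution F c g u \<longleftrightarrow> upper_semicontinuous u \<and>
     (\<forall>x p X \<epsilon> \<delta> \<epsilon>'. (p, X) \<in> superjet u x \<longrightarrow> upper_bound_pair u x p X \<epsilon> \<delta> \<longrightarrow>
        0 < \<epsilon>' \<longrightarrow> \<epsilon>' \<le> \<epsilon> \<longrightarrow>
        F x p X - near_integral c (X + 2 * \<delta>) \<epsilon>' - far_integral c u x p \<epsilon>' - g x \<le> 0)"

definition viscosity_supersolution ::
    "(real \<Rightarrow> real \<Rightarrow> real \<Rightarrow> real) \<Rightarrow> (real \<Rightarrow> real) \<Rightarrow> (real \<Rightarrow> real) \<Rightarrow> (real \<Rightarrow> real) \<Rightarrow> bool" where
  "viscosity_supersolution F c g u \<longleftrightarrow> lower_semicontinuous u \<and>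
     (\<forall>x p X \<epsilon> \<delta> \<epsilon>'. (p, X) \<in> subjet u x \<longrightarrow> lower_bound_pair u x p X \<epsilon> \<delta> \<longrightarrow>
        0 < \<epsilon>' \<longrightarrow> \<epsilon>' \<le> \<epsilon> \<longrightarrow>
        F x p X - near_integral c (X - 2 * \<delta>) \<epsilon>' - far_integral c u x p \<epsilon>' - g x \<ge> 0)"

definition viscosity_solution ::
    "(real \<Rightarrow> real \<Rightarrow> real \<Rightarrow> real) \<Rightarrow> (real \<Rightarrow> real) \<Rightarrow> (real \<Rightarrow> real) \<Rightarrow> (real \<Rightarrow> real) \<Rightarrow> bool" where
  "viscosity_solution F c g u \<longleftrightarrow>
     viscosity_subsolution F c g u \<and> viscosity_supersolution F c g u"

definition degenerate_elliptic :: "(real \<Rightarrow> real \<Rightarrow> real \<Rightarrow> real) \<Rightarrow> bool" where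
  "degenerate_elliptic F \<longleftrightarrow> (\<forall>x p X Y. X \<le> Y \<longrightarrow> F x p X \<ge> F x p Y)"

end

theory Submission
  imports Defs
begin

text \<open>
  Ishii--Lions doubling with modulus \<^term>\<open>\<lambda>s. C * s powr \<theta>\<close>. If the estimate fails, maximise
  \<open>v x - v y - C (x - y)\<^sup>\<theta>\<close> over \<open>y \<le> x\<close>, up to a penalty of small size \<open>b\<close>. The strict concavity
  of the modulus traps \<open>v\<close> below a straight line of slope \<open>p = C \<theta> s powr (\<theta> - 1)\<close> near a point close
  to \<open>x\<close> and above a line of the same slope near \<open>y\<close>, where \<open>s = x - y\<close>. In one dimension this makes
  \<open>(p, 0)\<close> a jet at both points, with exactly the same \<open>p\<close>, so that no theorem on sums is needed
  and \<open>F\<close>, whose continuity in \<open>(p, X)\<close> need not be uniform in \<open>x\<close>, is only compared at equal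
  \<open>(p, X)\<close>. Jumps of size between \<open>s / 4\<close> and \<open>s / 2\<close> contribute a gain of order \<open>C s powr (\<theta> - \<gamma>)\<close>
  to the difference of the two equations, which beats all other terms once \<open>C\<close> is large.

  The penalty costs \<open>b\<close> times the integral of \<open>min 1 \<bar>z\<bar>\<close> over \<open>\<bar>z\<bar> \<ge> s / 2\<close>, and \<open>s\<close> depends on \<open>b\<close>. For
  \<open>\<theta> < \<gamma>\<close> this is harmless at all scales; the uniform continuity obtained in this way keeps \<open>s\<close>
  away from \<open>0\<close>, which settles the remaining exponents.
\<close>

section \<open>Jets of straight lines\<close>

lemma semicontinuous_imp_continuous:
  assumes "upper_semicontinuous u" "lower_semicontinuous u"
  shows "continuous_on UNIV u"
proof -
  have "(u \<longlongrightarrow> u x) (at x)" for x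
    using assms unfolding upper_semicontinuous_def lower_semicontinuous_def
    by (intro order_tendstoI) (auto intro: eventually_nhds_conv_at[THEN iffD1, THEN conjunct1])
  then show ?thesis
    by (auto simp: continuous_on_def)
qed

text \<open>Only jets \<open>(p, 0)\<close> are tested, and only where the straight line bounds
  \<open>u\<close> without error on the whole ball of radius \<open>\<epsilon>\<close>.
  \<open>H x p\<close> stands for \<open>F x p 0\<close>, and there is no near integral because it
  vanishes in the limit \<delta> to 0.\<close>

definition line_subsolution ::
    "(real \<Rightarrow> real \<Rightarrow> real) \<Rightarrow> (real \<Rightarrow> real) \<Rightarrow> (real \<Rightarrow> real) \<Rightarrow> (real \<Rightarrow> real) \<Rightarrow> bool" where
  "line_subsolution H c g u \<longleftrightarrow> (\<forall>x p \<epsilon>. 0 < \<epsilon> \<longrightarrow> (\<forall>z. \<bar>z\<bar> \<le> \<epsilon> \<longrightarrow> u (x + z) \<le> u x + p * z) \<longrightarrow>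
     H x p - far_integral c u x p \<epsilon> - g x \<le> 0)"

definition line_supersolution ::
    "(real \<Rightarrow> real \<Rightarrow> real) \<Rightarrow> (real \<Rightarrow> real) \<Rightarrow> (real \<Rightarrow> real) \<Rightarrow> (real \<Rightarrow> real) \<Rightarrow> bool" where
  "line_supersolution H c g u \<longleftrightarrow> (\<forall>x p \<epsilon>. 0 < \<epsilon> \<longrightarrow> (\<forall>z. \<bar>z\<bar> \<le> \<epsilon> \<longrightarrow> u x + p * z \<le> u (x + z)) \<longrightarrow>
     H x p - far_integral c u x p \<epsilon> - g x \<ge> 0)"

text \<open>Scaling needs no integrability: for nonzero \<open>Y\<close> a divergent integral has
  the default value 0 on both sides.\<close>

lemma near_integral_scale: "near_integral c Y \<epsilon> = Y * near_integral c 1 \<epsilon>"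
proof -
  have "near_integral c Y \<epsilon> = (LINT z:{z. \<bar>z\<bar> < \<epsilon>}|lebesgue. Y * (1/2 * (1 * z\<^sup>2) * c z))"
    unfolding near_integral_def by (simp add: mult_ac)
  also have "\<dots> = Y * near_integral c 1 \<epsilon>"
    unfolding near_integral_def by (simp only: set_integral_mult_right)
  finally show ?thesis .
qed

lemma le_zero_if_le_scaled:
  fixes a N :: real
  assumes "\<And>\<delta>. \<delta> > 0 \<Longrightarrow> a \<le> \<delta> * N"
  shows "a \<le> 0"
proof (rule tendsto_lowerbound)
  show "((\<lambda>\<delta>. \<delta> * N) \<longlongrightarrow> 0) (at_right 0)"
    by (auto intro!: tendsto_eq_intros)
  show "\<forall>\<^sub>F \<delta> in at_right 0. a \<le> \<delta> * N"
    using assms by (auto simp: eventually_at_right_less intro: eventually_mono[OF eventually_at_right_less])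
qed simp

text \<open>A line lying above \<open>u\<close> on the ball of radius \<epsilon> gives the
  admissible pair (\<epsilon>, \<delta>) for every \<delta> > 0 with the same \<epsilon>. The near
  integral is then 2\<delta> times a fixed number, and letting \<delta> tend to 0 removes
  it.\<close>

lemma viscosity_subsolution_imp_line_subsolution:
  assumes "viscosity_subsolution F c g u"
  shows "line_subsolution (\<lambda>x p. F x p 0) c g u"
  unfolding line_subsolution_def
proof (intro allI impI)
  fix x p \<epsilon> :: real
  assume \<epsilon>: "0 < \<epsilon>" and le: "\<forall>z. \<bar>z\<bar> \<le> \<epsilon> \<longrightarrow> u (x + z) \<le> u x + p * z"
  have "\<forall>\<^sub>F z in at 0. \<bar>z\<bar> \<le> \<epsilon>"
    using \<epsilon> by (auto simp: eventually_at dist_real_def intro!: exI[of _ \<epsilon>])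
  then have jet: "(p, 0) \<in> superjet u x"
    unfolding superjet_def using le
    by (auto intro!: bexI[of _ "\<lambda>_. 0"] elim: eventually_mono)
  show "F x p 0 - far_integral c u x p \<epsilon> - g x \<le> 0"
  proof (rule le_zero_if_le_scaled)
    fix \<delta> :: real assume "\<delta> > 0"
    then have "upper_bound_pair u x p 0 \<epsilon> \<delta>"
      unfolding upper_bound_pair_def using \<epsilon> le by (auto intro: add_increasing2)
    with assms jet \<epsilon> have "F x p 0 - near_integral c (0 + 2 * \<delta>) \<epsilon> - far_integral c u x p \<epsilon> - g x \<le> 0"
      unfolding viscosity_subsolution_def by blast
    then show "F x p 0 - far_integral c u x p \<epsilon> - g x \<le> \<delta> * (2 * near_integral c 1 \<epsilon>)"
      by (subst (asm) near_integral_scale) (simp add: algebra_simps)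
  qed
qed

lemma viscosity_supersolution_imp_line_supersolution:
  assumes "viscosity_supersolution F c g u"
  shows "line_supersolution (\<lambda>x p. F x p 0) c g u"
  unfolding line_supersolution_def
proof (intro allI impI)
  fix x p \<epsilon> :: real
  assume \<epsilon>: "0 < \<epsilon>" and le: "\<forall>z. \<bar>z\<bar> \<le> \<epsilon> \<longrightarrow> u x + p * z \<le> u (x + z)"
  have "\<forall>\<^sub>F z in at 0. \<bar>z\<bar> \<le> \<epsilon>"
    using \<epsilon> by (auto simp: eventually_at dist_real_def intro!: exI[of _ \<epsilon>])
  then have jet: "(p, 0) \<in> subjet u x"
    unfolding subjet_def using le
    by (auto intro!: bexI[of _ "\<lambda>_. 0"] elim: eventually_mono)
  have "- (F x p 0 - far_integral c u x p \<epsilon> - g x) \<le> 0"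
  proof (rule le_zero_if_le_scaled)
    fix \<delta> :: real assume "\<delta> > 0"
    then have "lower_bound_pair u x p 0 \<epsilon> \<delta>"
      unfolding lower_bound_pair_def using \<epsilon> le
      by (auto simp: algebra_simps intro: add_increasing2)
    with assms jet \<epsilon> have "F x p 0 - near_integral c (0 - 2 * \<delta>) \<epsilon> - far_integral c u x p \<epsilon> - g x \<ge> 0"
      unfolding viscosity_supersolution_def by blast
    then show "- (F x p 0 - far_integral c u x p \<epsilon> - g x) \<le> \<delta> * (2 * near_integral c 1 \<epsilon>)"
      by (subst (asm) near_integral_scale) (simp add: algebra_simps)
  qed
  then show "F x p 0 - far_integral c u x p \<epsilon> - g x \<ge> 0" by simp
qed

section \<open>Symmetry of the problem under changing the sign of the solution\<close>

lemma far_integral_uminus: "far_integral c (\<lambda>x. - u x) x p \<epsilon> = - far_integral c u x (- p) \<epsilon>"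
proof -
  have "far_integral c (\<lambda>x. - u x) x p \<epsilon> =
      (LINT z:{z. \<epsilon> \<le> \<bar>z\<bar>}|lebesgue. - 1 * ((u (x + z) - u x - of_bool (\<bar>z\<bar> \<le> 1) * (z * - p)) * c z))"
    unfolding far_integral_def by (simp add: algebra_simps)
  also have "\<dots> = - far_integral c u x (- p) \<epsilon>"
    unfolding far_integral_def by (simp only: set_integral_mult_right)
  finally show ?thesis .
qed

text \<open>Negation exchanges sub- and supersolutions and turns \<open>H x p\<close> into
  \<open>- H x (- p)\<close>, which has the same modulus of continuity in \<open>x\<close>. This
  later turns an upper bound for \<open>v x - v y\<close> with \<open>y < x\<close> into a bound for
  its absolute value.\<close>

lemma line_subsolution_uminus:
  assumes "line_supersolution H c g u"
  shows "line_subsolution (\<lambda>x p. - H x (- p)) c (\<lambda>x. - g x) (\<lambda>x. - u x)"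
  unfolding line_subsolution_def
proof (intro allI impI)
  fix x p \<epsilon> :: real
  assume "0 < \<epsilon>" "\<forall>z. \<bar>z\<bar> \<le> \<epsilon> \<longrightarrow> - u (x + z) \<le> - u x + p * z"
  then have "H x (- p) - far_integral c u x (- p) \<epsilon> - g x \<ge> 0"
    by (intro assms[unfolded line_supersolution_def, rule_format]) (auto simp: algebra_simps)
  then show "- H x (- p) - far_integral c (\<lambda>x. - u x) x p \<epsilon> - - g x \<le> 0"
    by (simp add: far_integral_uminus)
qed

lemma line_supersolution_uminus:
  assumes "line_subsolution H c g u"
  shows "line_supersolution (\<lambda>x p. - H x (- p)) c (\<lambda>x. - g x) (\<lambda>x. - u x)"
  unfolding line_supersolution_def
proof (intro allI impI)
  fix x p \<epsilon> :: real
  assume "0 < \<epsilon>" "\<forall>z. \<bar>z\<bar> \<le> \<epsilon> \<longrightarrow> - u x + p * z \<le> - u (x + z)"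
  then have "H x (- p) - far_integral c u x (- p) \<epsilon> - g x \<le> 0"
    by (intro assms[unfolded line_subsolution_def, rule_format]) (auto simp: algebra_simps)
  then show "- H x (- p) - far_integral c (\<lambda>x. - u x) x p \<epsilon> - - g x \<ge> 0"
    by (simp add: far_integral_uminus)
qed

section \<open>Concavity of the modulus and the doubled maximum\<close>

text \<open>For t in (-1, 1] the second derivative of the power is at most -\<theta>(1 -
  \<theta>)/4, because (1 + t) powr (\<theta> - 2) is at least 2 powr (-2). Half of this constant is
  the factor 1/8; the bound is the tangent inequality at 0 for the convex function
  \<open>f\<close>.\<close>

lemma one_plus_powr_le:
  fixes \<theta> t :: real
  assumes \<theta>: "0 < \<theta>" "\<theta> < 1" and t: "- 1 < t" "t \<le> 1"
  shows "(1 + t) powr \<theta> \<le> 1 + \<theta> * t - \<theta> * (1 - \<theta>) / 8 * t\<^sup>2"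
proof -
  define k where "k = \<theta> * (1 - \<theta>) / 8"
  define f where "f = (\<lambda>t. - k * t\<^sup>2 - (1 + t) powr \<theta>)"
  define A where "A = {- 1 <.. (1::real)}"
  have "convex_on A f"
  proof (rule f''_ge0_imp_convex)
    show "convex A" by (simp add: A_def)
    fix x assume "x \<in> A"
    then have x: "- 1 < x" "x \<le> 1" by (auto simp: A_def)
    show "(f has_real_derivative (- 2 * k * x - \<theta> * (1 + x) powr (\<theta> - 1))) (at x)"
      unfolding f_def using x by (auto intro!: derivative_eq_intros)
    show "((\<lambda>x. - 2 * k * x - \<theta> * (1 + x) powr (\<theta> - 1)) has_real_derivative
        (- 2 * k - \<theta> * ((\<theta> - 1) * (1 + x) powr (\<theta> - 2)))) (at x)"
      using x by (auto intro!: derivative_eq_intros)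
    have "(2::real) powr (- 2) \<le> 2 powr (\<theta> - 2)"
      using \<theta> by (intro powr_mono) auto
    also have "\<dots> \<le> (1 + x) powr (\<theta> - 2)"
      using x \<theta> by (intro powr_mono2') auto
    finally have "1 / 4 \<le> (1 + x) powr (\<theta> - 2)" by (simp add: powr_minus)
    then have "\<theta> * (1 - \<theta>) * (1 / 4) \<le> \<theta> * (1 - \<theta>) * (1 + x) powr (\<theta> - 2)"
      using \<theta> by (intro mult_left_mono) auto
    then show "0 \<le> - 2 * k - \<theta> * ((\<theta> - 1) * (1 + x) powr (\<theta> - 2))"
      by (simp add: k_def field_simps)
  qed
  moreover have "(f has_real_derivative - \<theta>) (at 0 within A)"
    unfolding f_def by (auto intro!: derivative_eq_intros)
  ultimately have "f t - f 0 \<ge> - \<theta> * (t - 0)"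
    using t by (intro convex_on_imp_above_tangent) (auto simp: A_def interior_open)
  then show ?thesis by (simp add: f_def k_def)
qed

text \<open>This is the preceding inequality at \<open>t = z / s\<close>. The linear coefficient is
  the common slope of the touching lines, and the quadratic term is the source of the gain in the
  nonlocal part.\<close>

lemma powr_concavity_gap:
  fixes \<theta> C s z :: real
  assumes \<theta>: "0 < \<theta>" "\<theta> < 1" and "C > 0" "s > 0" and z: "- s < z" "z \<le> s"
  shows "C * (s + z) powr \<theta> \<le> C * s powr \<theta> + C * \<theta> * s powr (\<theta> - 1) * z
           - \<theta> * (1 - \<theta>) / 8 * C * s powr (\<theta> - 2) * z\<^sup>2"
proof -
  define t where "t = z / s"
  have t: "- 1 < t" "t \<le> 1" and zt: "z = s * t"
    using assms by (auto simp: t_def field_simps)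
  have p1: "s powr (\<theta> - 1) * s = s powr \<theta>" 
    using \<open>s > 0\<close> by (simp add: powr_diff)
  have p2: "s powr (\<theta> - 2) * s\<^sup>2 = s powr \<theta>"
    using \<open>s > 0\<close> by (simp add: powr_diff)
  have "C * (s + z) powr \<theta> = C * s powr \<theta> * (1 + t) powr \<theta>"
    using t \<open>s > 0\<close> by (simp add: zt powr_mult[symmetric] algebra_simps)
  also have "\<dots> \<le> C * s powr \<theta> * (1 + \<theta> * t - \<theta> * (1 - \<theta>) / 8 * t\<^sup>2)"
    using one_plus_powr_le[OF \<theta> t] \<open>C > 0\<close> by (intro mult_left_mono) auto
  also have "\<dots> = C * s powr \<theta> + C * \<theta> * (s powr (\<theta> - 1) * s) * t
           - \<theta> * (1 - \<theta>) / 8 * C * (s powr (\<theta> - 2) * s\<^sup>2) * t\<^sup>2"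
    unfolding p1 p2 by (simp add: algebra_simps)
  finally show ?thesis by (simp add: zt power_mult_distrib mult_ac)
qed

text \<open>The domain is unbounded, so the supremum need not be attained; the penalty repairs this and
  its oscillation stays below \<open>b\<close>, whatever the behaviour of \<open>v\<close> at infinity.\<close>

lemma penalised_maximum:
  fixes v :: "real \<Rightarrow> real"
  assumes cont: "continuous_on UNIV v" and bdd: "\<And>x. \<bar>v x\<bar> \<le> M"
    and C: "C > 0" "2 * M \<le> C" and "b > 0" "\<theta> > 0"
    and "y1 < x1" and T: "T = v x1 - v y1 - C * (x1 - y1) powr \<theta>" "T > 0"
  obtains x y where "y < x" "x - y \<le> 1" "T \<le> v x - v y - C * (x - y) powr \<theta>"
    "\<And>x' y'. y' \<le> x' \<Longrightarrow>
      v x' - v y' - C * (x' - y') powr \<theta> \<le> v x - v y - C * (x - y) powr \<theta> + b * min 1 \<bar>x' - x\<bar>"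
proof -
  \<comment> \<open>In the coordinates \<open>(x, t)\<close> with \<open>t = x - y\<close> the
    constraint is simply \<open>0 \<le> t\<close>.\<close>
  define \<Phi> where "\<Phi> = (\<lambda>x t. v x - v (x - t) - C * t powr \<theta>)"
  define V where "V = {\<Phi> x t |x t. 0 \<le> t}"
  have \<Phi>_le: "\<Phi> x t \<le> 2 * M" for x t
  proof -
    have "0 \<le> C * t powr \<theta>" using C by simp
    then show ?thesis using bdd[of x] bdd[of "x - t"] unfolding \<Phi>_def by linarith
  qed
  have T1: "T = \<Phi> x1 (x1 - y1)" by (simp add: T \<Phi>_def)
  have bddV: "bdd_above V" using \<Phi>_le by (auto simp: V_def intro!: bdd_aboveI[of _ "2 * M"])
  have TV: "T \<in> V" using T1 \<open>y1 < x1\<close> by (force simp: V_def)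
  \<comment> \<open>A point within \<open>b\<close> of the supremum serves as the centre of the
    penalty. The case split ensures that its value is also at least \<open>T\<close>.\<close>
  have "\<exists>x t. 0 \<le> t \<and> T \<le> \<Phi> x t \<and> Sup V - b < \<Phi> x t"
  proof (cases "Sup V - b < T")
    case True
    then show ?thesis using T1 \<open>y1 < x1\<close> by (intro exI[of _ x1] exI[of _ "x1 - y1"]) auto
  next
    case False
    have "\<exists>a\<in>V. Sup V - b < a" using TV \<open>b > 0\<close> by (intro less_cSupD) auto
    with False show ?thesis by (force simp: V_def)
  qed
  then obtain x0 t0 where x0: "0 \<le> t0" "T \<le> \<Phi> x0 t0" "Sup V - b < \<Phi> x0 t0" by blast
  \<comment> \<open>Since \<open>2 * M \<le> C\<close>, separations above 1 cannot compete with the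
    positive value \<open>T\<close>, so \<open>t\<close> may be confined to [0, 1].\<close>
  have \<Phi>_large: "\<Phi> x t \<le> 0" if "1 < t" for x t
  proof -
    have "1 \<le> t powr \<theta>" using that \<open>\<theta> > 0\<close> by (simp add: ge_one_powr_ge_zero)
    then have "C * 1 \<le> C * t powr \<theta>" using C by (intro mult_left_mono) auto
    then show ?thesis using bdd[of x] bdd[of "x - t"] C unfolding \<Phi>_def by linarith
  qed
  have t0: "t0 \<le> 1" using \<Phi>_large[of t0 x0] x0 T by linarith
  define \<Psi> where "\<Psi> = (\<lambda>(x, t). \<Phi> x t - b * min 1 \<bar>x - x0\<bar>)"
  define K where "K = {x0 - 1..x0 + 1} \<times> {0..1::real}"
  have "continuous_on K \<Psi>"
    unfolding \<Psi>_def \<Phi>_def K_def case_prod_beta using \<open>\<theta> > 0\<close>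
    by (intro continuous_intros continuous_on_compose2[OF cont] continuous_on_powr') auto
  moreover have "compact K" "K \<noteq> {}" unfolding K_def by (auto intro: compact_Times)
  ultimately obtain k where k: "k \<in> K" "\<And>k'. k' \<in> K \<Longrightarrow> \<Psi> k' \<le> \<Psi> k"
    using continuous_attains_sup[of K \<Psi>] by blast
  obtain x t where kxt: "k = (x, t)" by force
  have t: "0 \<le> t" "t \<le> 1" using k by (auto simp: K_def kxt)
  have "(x0, t0) \<in> K" using x0 t0 by (auto simp: K_def)
  then have ge0: "\<Phi> x0 t0 \<le> \<Psi> (x, t)" using k(2)[of "(x0, t0)"] by (simp add: \<Psi>_def kxt)
  have \<Psi>_le: "\<Psi> (x', t') \<le> \<Psi> (x, t)" if "0 \<le> t'" for x' t'
  proof -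
    have "(x', t') \<in> K" if "t' \<le> 1" "\<bar>x' - x0\<bar> \<le> 1"
      using that \<open>0 \<le> t'\<close> by (auto simp: K_def)
    then consider "t' > 1" | "\<bar>x' - x0\<bar> > 1" | "(x', t') \<in> K" by linarith
    then show ?thesis
    proof cases
      case 1
      have "0 \<le> b * min 1 \<bar>x' - x0\<bar>" using \<open>b > 0\<close> by simp
      with 1 have "\<Psi> (x', t') \<le> 0"
        using \<Phi>_large[of t' x'] unfolding \<Psi>_def prod.case by linarith
      then show ?thesis using ge0 x0 T by linarith
    next
      case 2
      \<comment> \<open>At distance more than 1 from \<open>x0\<close> the full penalty
        \<open>b\<close> is paid, which puts the value below that of the near-maximiser
        \<open>(x0, t0)\<close>.\<close>
      have "\<Phi> x' t' \<in> V" using that by (auto simp: V_def)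
      then have "\<Phi> x' t' \<le> Sup V" using bddV by (rule cSup_upper)
      with 2 have "\<Psi> (x', t') \<le> Sup V - b" by (simp add: \<Psi>_def)
      then show ?thesis using ge0 x0 by linarith
    next
      case 3
      then show ?thesis using k(2) kxt by simp
    qed
  qed
  have "0 \<le> b * min 1 \<bar>x - x0\<bar>" using \<open>b > 0\<close> by simp
  then have "\<Psi> (x, t) \<le> \<Phi> x t" by (simp add: \<Psi>_def)
  then have TT: "T \<le> \<Phi> x t" using ge0 x0 by linarith
  have tpos: "0 < t"
  proof (rule ccontr)
    assume "\<not> 0 < t"
    then have "t = 0" using t by simp
    then have "\<Phi> x t = 0" by (simp add: \<Phi>_def)
    then show False using TT T by simp
  qed
  show ?thesis
  proof
    show "x - t < x" "x - (x - t) \<le> 1" using tpos t by auto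
    show "T \<le> v x - v (x - t) - C * (x - (x - t)) powr \<theta>" using TT by (simp add: \<Phi>_def)
    fix x' y' :: real assume "y' \<le> x'"
    then have "\<Psi> (x', x' - y') \<le> \<Psi> (x, t)" using \<Psi>_le by simp
    \<comment> \<open>The truncated distance satisfies the triangle inequality, so the penalty can
      be recentred from \<open>x0\<close> to the maximiser \<open>x\<close>.\<close>
    moreover have "min 1 \<bar>x' - x0\<bar> \<le> min 1 \<bar>x - x0\<bar> + min 1 \<bar>x' - x\<bar>" by linarith
    then have "b * min 1 \<bar>x' - x0\<bar> \<le> b * min 1 \<bar>x - x0\<bar> + b * min 1 \<bar>x' - x\<bar>"
      using \<open>b > 0\<close> by (simp add: distrib_left[symmetric] mult_left_mono del: min_less_iff_conj)
    ultimately show "v x' - v y' - C * (x' - y') powr \<theta>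
        \<le> v x - v (x - t) - C * (x - (x - t)) powr \<theta> + b * min 1 \<bar>x' - x\<bar>"
      by (simp add: \<Psi>_def \<Phi>_def)
  qed
qed

text \<open>Moving only \<open>y\<close> in the maximality inequality puts \<open>v\<close> above a
  line at \<open>y\<close>, with a quadratic margin. Moving only \<open>x\<close> puts it below a
  line, but the penalty spoils this by \<open>b * \<bar>z\<bar>\<close>. Sliding the line of the
  same slope until it touches replaces \<open>x\<close> by a nearby \<open>x'\<close>; since the
  penalty depends on the first variable only, \<open>y\<close> stays.\<close>

lemma touching_lines:
  fixes v :: "real \<Rightarrow> real" and x y C b \<theta> :: real
  assumes cont: "continuous_on UNIV v" and \<theta>: "0 < \<theta>" "\<theta> < 1" and C: "C > 0"
    and b: "0 \<le> b" "b \<le> \<theta> * (1 - \<theta>) / 8 * C / 128"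
    and s: "s = x - y" "0 < s" "s \<le> 1"
    and max: "\<And>x' y'. y' \<le> x' \<Longrightarrow>
      v x' - v y' - C * (x' - y') powr \<theta> \<le> v x - v y - C * (x - y) powr \<theta> + b * min 1 \<bar>x' - x\<bar>"
  defines "p \<equiv> C * \<theta> * s powr (\<theta> - 1)"
  obtains x' where "\<bar>x' - x\<bar> \<le> s / 8"
    "\<And>z. \<bar>z\<bar> \<le> s / 4 \<Longrightarrow> v (x' + z) \<le> v x' + p * z"
    "\<And>z. \<bar>z\<bar> \<le> s / 4 \<Longrightarrow> v y + p * z \<le> v (y + z)"
    "\<And>z. s / 4 \<le> \<bar>z\<bar> \<Longrightarrow> \<bar>z\<bar> \<le> s / 2 \<Longrightarrow>
      (v (x' + z) - v x') - (v (y + z) - v y) \<le> - (\<theta> * (1 - \<theta>) / 8 * C / 128 * s powr \<theta>)"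
    "\<And>z. s / 2 \<le> \<bar>z\<bar> \<Longrightarrow> (v (x' + z) - v x') - (v (y + z) - v y) \<le> 2 * b * min 1 \<bar>z\<bar>"
proof -
  define \<kappa> where "\<kappa> = \<theta> * (1 - \<theta>) / 8 * C * s powr (\<theta> - 2)"
  have "\<kappa> > 0" using \<theta> C s by (simp add: \<kappa>_def)
  have \<kappa>_nonneg: "0 \<le> \<kappa> * z\<^sup>2" for z using \<open>\<kappa> > 0\<close> by simp
  have \<kappa>s2: "\<kappa> * s\<^sup>2 = \<theta> * (1 - \<theta>) / 8 * C * s powr \<theta>"
    using s by (simp add: \<kappa>_def powr_diff)
  \<comment> \<open>As \<open>s \<le> 1\<close>, a bound on \<open>b\<close> that does not involve
    \<open>s\<close> suffices for \<open>b \<le> \<kappa> * s / 128\<close>.\<close>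
  have "1 \<le> s powr (\<theta> - 1)" using powr_mono'[of "\<theta> - 1" 0 s] s \<theta> by simp
  then have "\<theta> * (1 - \<theta>) / 8 * C * 1 \<le> \<theta> * (1 - \<theta>) / 8 * C * s powr (\<theta> - 1)"
    using \<theta> C by (intro mult_left_mono) auto
  also have "s powr (\<theta> - 1) = s powr (\<theta> - 2) * s"
    using s by (simp add: powr_diff power2_eq_square)
  finally have b\<kappa>: "b \<le> \<kappa> * s / 128" using b by (simp add: \<kappa>_def field_simps)
  have concave: "C * (s + z) powr \<theta> \<le> C * s powr \<theta> + p * z - \<kappa> * z\<^sup>2" if "- s < z" "z \<le> s" for z
    using powr_concavity_gap[OF \<theta> C s(2) that] by (simp add: p_def \<kappa>_def)
  have above: "v (x + z) \<le> v x + p * z - \<kappa> * z\<^sup>2 + b * \<bar>z\<bar>" if "- s < z" "z \<le> s" for z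
  proof -
    have "v (x + z) - v y - C * (s + z) powr \<theta> \<le> v x - v y - C * s powr \<theta> + b * min 1 \<bar>z\<bar>"
    proof -
      have e: "x + z - y = s + z" "x - y = s" "x + z - x = z" by (simp_all add: s(1))
      have "y \<le> x + z" using that s by linarith
      from max[OF this] show ?thesis unfolding e .
    qed
    moreover have "b * min 1 \<bar>z\<bar> \<le> b * \<bar>z\<bar>" using b by (intro mult_left_mono) auto
    ultimately show ?thesis using concave[OF that] by linarith
  qed
  have below: "v y + p * z + \<kappa> * z\<^sup>2 \<le> v (y + z)" if "- s \<le> z" "z < s" for z
  proof -
    have "v x - v (y + z) - C * (s - z) powr \<theta> \<le> v x - v y - C * s powr \<theta>"
    proof -
      have e: "x - (y + z) = s - z" "x - y = s" by (simp_all add: s(1))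
      have "y + z \<le> x" using that s by linarith
      from max[OF this] show ?thesis unfolding e by simp
    qed
    then show ?thesis using concave[of "- z"] that by simp
  qed
  \<comment> \<open>\<open>x + \<zeta>\<close> is the contact point: it maximises \<open>v\<close>
    minus the line of slope \<open>p\<close> within distance \<open>s / 2\<close> of
    \<open>x\<close>.\<close>
  have "\<exists>\<zeta>\<in>{- (s / 2)..s / 2}. \<forall>z\<in>{- (s / 2)..s / 2}. v (x + z) - p * z \<le> v (x + \<zeta>) - p * \<zeta>"
    using s(2) by (intro continuous_attains_sup)
      (auto intro!: continuous_intros continuous_on_compose2[OF cont])
  then obtain \<zeta> where \<zeta>: "- (s / 2) \<le> \<zeta>" "\<zeta> \<le> s / 2"
    "\<And>z. - (s / 2) \<le> z \<Longrightarrow> z \<le> s / 2 \<Longrightarrow> v (x + z) - p * z \<le> v (x + \<zeta>) - p * \<zeta>"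
    by auto
  have v\<zeta>: "v x + p * \<zeta> \<le> v (x + \<zeta>)" using \<zeta>(3)[of 0] s by simp
  have small: "\<bar>\<zeta>\<bar> \<le> s / 128"
  proof (rule ccontr)
    assume *: "\<not> \<bar>\<zeta>\<bar> \<le> s / 128"
    \<comment> \<open>Comparing the maximal value at \<zeta> with the value at 0, the quadratic
      margin can be offset only by the penalty, which is too weak beyond distance
      \<open>s / 128\<close>.\<close>
    have "\<kappa> * \<zeta>\<^sup>2 \<le> b * \<bar>\<zeta>\<bar>" using v\<zeta> above[of \<zeta>] \<zeta> s by simp
    also have "\<dots> \<le> \<kappa> * s / 128 * \<bar>\<zeta>\<bar>" using b\<kappa> by (intro mult_right_mono) auto
    also have "\<dots> < \<kappa> * \<zeta>\<^sup>2"
    proof -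
      have "s / 128 * \<bar>\<zeta>\<bar> < \<bar>\<zeta>\<bar> * \<bar>\<zeta>\<bar>" using * s(2) by (intro mult_strict_right_mono) linarith+
      then have "\<kappa> * (s / 128 * \<bar>\<zeta>\<bar>) < \<kappa> * (\<bar>\<zeta>\<bar> * \<bar>\<zeta>\<bar>)"
        using \<open>\<kappa> > 0\<close> by (rule mult_strict_left_mono)
      then show ?thesis by (simp add: power2_eq_square)
    qed
    finally show False by simp
  qed
  show ?thesis
  proof
    show "\<bar>x + \<zeta> - x\<bar> \<le> s / 8" using small s by simp
    show "v (x + \<zeta> + z) \<le> v (x + \<zeta>) + p * z" if "\<bar>z\<bar> \<le> s / 4" for z
    proof -
      have "- (s / 2) \<le> \<zeta> + z" "\<zeta> + z \<le> s / 2" using that small s(2) by linarith+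
      from \<zeta>(3)[OF this] show ?thesis by (simp add: algebra_simps)
    qed
    show "v y + p * z \<le> v (y + z)" if "\<bar>z\<bar> \<le> s / 4" for z
    proof -
      have "- s \<le> z" "z < s" using that s(2) by linarith+
      from below[OF this] show ?thesis using \<kappa>_nonneg[of z] by linarith
    qed
    show "(v (x + \<zeta> + z) - v (x + \<zeta>)) - (v (y + z) - v y)
        \<le> - (\<theta> * (1 - \<theta>) / 8 * C / 128 * s powr \<theta>)" if z: "s / 4 \<le> \<bar>z\<bar>" "\<bar>z\<bar> \<le> s / 2" for z
    proof -
      \<comment> \<open>On these jumps the distance \<open>r\<close> to the original point
        \<open>x\<close> lies between \<open>s / 8\<close> and \<open>s\<close>. Then r(r - s/128)
        is at least 15 s^2 / 1024, which leaves the margin s^2 / 128.\<close>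
      define r where "r = \<bar>\<zeta> + z\<bar>"
      have r: "s / 8 \<le> r" "r \<le> s" unfolding r_def using z small s(2) by linarith+
      have "v (x + (\<zeta> + z)) \<le> v x + p * (\<zeta> + z) - \<kappa> * (\<zeta> + z)\<^sup>2 + b * r"
        unfolding r_def using z small s by (intro above) linarith+
      moreover have "v y + p * z \<le> v (y + z)"
      proof -
        have "- s \<le> z" "z < s" using z s(2) by linarith+
        from below[OF this] show ?thesis using \<kappa>_nonneg[of z] by linarith
      qed
      moreover have "- \<kappa> * (\<zeta> + z)\<^sup>2 + b * r \<le> - (\<kappa> * s\<^sup>2) / 128"
      proof -
        have "b * r \<le> \<kappa> * s / 128 * r" using b\<kappa> r s by (intro mult_right_mono) auto
        moreover have "(s / 8) * (s / 8 - s / 128) \<le> r * (r - s / 128)"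
          using r s(2) by (intro mult_mono) linarith+
        then have "\<kappa> * ((s / 8) * (s / 8 - s / 128)) \<le> \<kappa> * (r * (r - s / 128))"
          using \<open>\<kappa> > 0\<close> by (intro mult_left_mono) auto
        moreover have "0 \<le> \<kappa> * s\<^sup>2" using \<open>\<kappa> > 0\<close> by simp
        moreover have "(\<zeta> + z)\<^sup>2 = r\<^sup>2" by (simp add: r_def)
        ultimately show ?thesis by (simp add: power2_eq_square algebra_simps)
      qed
      ultimately show ?thesis using v\<zeta> \<kappa>s2 by (simp add: algebra_simps)
    qed
    show "(v (x + \<zeta> + z) - v (x + \<zeta>)) - (v (y + z) - v y) \<le> 2 * b * min 1 \<bar>z\<bar>"
      if z: "s / 2 \<le> \<bar>z\<bar>" for z
    proof -
      \<comment> \<open>Shifting both points by the same \<open>z\<close> leaves the separation at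
        \<open>s + \<zeta>\<close>, so beyond the line estimate only the penalty is lost. It is at
        most \<open>2 * b * min 1 \<bar>z\<bar>\<close>, as \<zeta> is shorter than
        \<open>z\<close>.\<close>
      have "v (x + \<zeta> + z) - v (y + z) - C * (s + \<zeta>) powr \<theta> \<le> v x - v y - C * s powr \<theta> + b * min 1 \<bar>\<zeta> + z\<bar>"
      proof -
        have e: "x + \<zeta> + z - (y + z) = s + \<zeta>" "x - y = s" "x + \<zeta> + z - x = \<zeta> + z"
          by (simp_all add: s(1))
        have "y + z \<le> x + \<zeta> + z" using small s by linarith
        from max[OF this] show ?thesis unfolding e .
      qed
      moreover have "C * (s + \<zeta>) powr \<theta> \<le> C * s powr \<theta> + p * \<zeta>"
      proof -
        have "- s < \<zeta>" "\<zeta> \<le> s" using small s(2) by linarith+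
        from concave[OF this] show ?thesis using \<kappa>_nonneg[of \<zeta>] by linarith
      qed
      moreover have "b * min 1 \<bar>\<zeta> + z\<bar> \<le> b * (2 * min 1 \<bar>z\<bar>)"
        using b small z s by (intro mult_left_mono) linarith+
      ultimately show ?thesis using v\<zeta> by (simp add: algebra_simps)
    qed
  qed
qed

section \<open>Integrals against the jump kernel\<close>

locale jump_kernel =
  fixes c :: "real \<Rightarrow> real" and C\<^sub>1 C\<^sub>2 C\<^sub>3 \<gamma> :: real
  assumes density: "positive_radon_density c"
    and total_mass: "(\<integral>\<^sup>+z. ennreal (min (\<bar>z\<bar>\<^sup>2) 1 * c z) \<partial>lebesgue) \<le> ennreal C\<^sub>1"
    and near_zero: "\<And>z. 0 < \<bar>z\<bar> \<Longrightarrow> \<bar>z\<bar> \<le> 1 \<Longrightarrow>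
      C\<^sub>2 / \<bar>z\<bar> powr (1 + \<gamma>) \<le> \<bar>c z\<bar> \<and> \<bar>c z\<bar> \<le> C\<^sub>3 / \<bar>z\<bar> powr (1 + \<gamma>)"
    and pos: "0 < C\<^sub>1" "0 < C\<^sub>2" "0 < C\<^sub>3" "0 < \<gamma>"
begin

lemma measurable_c [measurable]: "c \<in> borel_measurable lebesgue"
  using density by (simp add: positive_radon_density_def)

lemma c_nonneg: "z \<noteq> 0 \<Longrightarrow> 0 \<le> c z"
  using density by (simp add: positive_radon_density_def)

lemma c_bounds:
  assumes "0 < \<bar>z\<bar>" "\<bar>z\<bar> \<le> 1"
  shows "C\<^sub>2 / \<bar>z\<bar> powr (1 + \<gamma>) \<le> c z" "c z \<le> C\<^sub>3 / \<bar>z\<bar> powr (1 + \<gamma>)"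
  using near_zero[OF assms] c_nonneg[of z] assms by auto

lemma min_sq_c_nonneg: "0 \<le> min (\<bar>z\<bar>\<^sup>2) 1 * c z"
  using c_nonneg[of z] by (cases "z = 0") auto

lemma measurable_min_sq_c: "(\<lambda>z. min (\<bar>z\<bar>\<^sup>2) 1 * c z) \<in> borel_measurable lebesgue"
  by (intro borel_measurable_times measurable_completion measurable_c) simp

lemma integrable_min_sq_c: "integrable lebesgue (\<lambda>z. min (\<bar>z\<bar>\<^sup>2) 1 * c z)"
  using total_mass min_sq_c_nonneg measurable_min_sq_c
  by (intro integrableI_nonneg) (auto simp: le_less_trans)

lemma integral_min_sq_c: "(LINT z|lebesgue. min (\<bar>z\<bar>\<^sup>2) 1 * c z) \<le> C\<^sub>1"
proof -
  have "(LINT z|lebesgue. min (\<bar>z\<bar>\<^sup>2) 1 * c z) = enn2real (\<integral>\<^sup>+z. ennreal (min (\<bar>z\<bar>\<^sup>2) 1 * c z) \<partial>lebesgue)"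
    using min_sq_c_nonneg measurable_min_sq_c by (intro integral_eq_nn_integral) auto
  also have "\<dots> \<le> enn2real (ennreal C\<^sub>1)"
    using total_mass by (intro enn2real_mono) auto
  finally show ?thesis using pos by simp
qed

lemma sets_far [measurable]: "{z::real. \<epsilon> \<le> \<bar>z\<bar>} \<in> sets lebesgue"
proof -
  have "closed {z::real. \<epsilon> \<le> \<bar>z\<bar>}" by (intro closed_Collect_le continuous_intros)
  then have "{z::real. \<epsilon> \<le> \<bar>z\<bar>} \<in> sets lborel" by (simp add: borel_closed)
  then show ?thesis by (rule sets_completionI_sets)
qed

text \<open>Away from 0 the weight min(z^2, 1) is bounded below by \<open>m\<close>, so a bounded
  factor is dominated by \<open>K / m\<close> times the integrable function.\<close>

lemma set_integrable_far:
  assumes "0 < \<epsilon>" and h: "h \<in> borel_measurable borel"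
    and K: "\<And>z. \<epsilon> \<le> \<bar>z\<bar> \<Longrightarrow> \<bar>h z\<bar> \<le> K"
  shows "set_integrable lebesgue {z. \<epsilon> \<le> \<bar>z\<bar>} (\<lambda>z. h z * c z)"
  unfolding set_integrable_def
proof (rule Bochner_Integration.integrable_bound)
  define m where "m = min (\<epsilon>\<^sup>2) 1"
  have m: "0 < m" using assms by (simp add: m_def)
  show "integrable lebesgue (\<lambda>z. K / m * (min (\<bar>z\<bar>\<^sup>2) 1 * c z))"
    by (intro integrable_mult_right integrable_min_sq_c)
  have [measurable]: "h \<in> borel_measurable lebesgue"
    using h by (intro measurable_completion) simp
  show "(\<lambda>z. indicator {z. \<epsilon> \<le> \<bar>z\<bar>} z *\<^sub>R (h z * c z)) \<in> borel_measurable lebesgue"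
    by measurable
  have "\<bar>h z * c z\<bar> \<le> \<bar>K / m * (min (\<bar>z\<bar>\<^sup>2) 1 * c z)\<bar>" if z: "\<epsilon> \<le> \<bar>z\<bar>" for z
  proof -
    have c: "0 \<le> c z" using c_nonneg[of z] z assms by fastforce
    have K0: "0 \<le> K" using K[OF z] by linarith
    have "m \<le> min (\<bar>z\<bar>\<^sup>2) 1" using power_mono[OF z, of 2] assms by (auto simp: m_def)
    then have "K / m * m \<le> K / m * min (\<bar>z\<bar>\<^sup>2) 1" using K0 m by (intro mult_left_mono) auto
    then have "\<bar>h z\<bar> \<le> K / m * min (\<bar>z\<bar>\<^sup>2) 1" using K[OF z] m by simp
    then have "\<bar>h z\<bar> * c z \<le> K / m * min (\<bar>z\<bar>\<^sup>2) 1 * c z" using c by (rule mult_right_mono)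
    then show ?thesis using c using K0 m by (simp add: abs_mult mult.assoc)
  qed
  then show "AE z in lebesgue. norm (indicator {z. \<epsilon> \<le> \<bar>z\<bar>} z *\<^sub>R (h z * c z))
      \<le> norm (K / m * (min (\<bar>z\<bar>\<^sup>2) 1 * c z))"
    by (intro AE_I2) (auto split: split_indicator)
qed

text \<open>This is the price of the penalty per unit of \<open>2 * b\<close>, paid on jumps of size
  at least \<open>s / 2\<close>.\<close>

definition tail :: "real \<Rightarrow> real" where
  "tail s = (LINT z:{z. s / 2 \<le> \<bar>z\<bar>}|lebesgue. min 1 \<bar>z\<bar> * c z)"

lemma set_integrable_tail:
  assumes "0 < s"
  shows "set_integrable lebesgue {z. s / 2 \<le> \<bar>z\<bar>} (\<lambda>z. min 1 \<bar>z\<bar> * c z)"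
  using assms by (intro set_integrable_far[where K = 1]) auto

text \<open>On \<open>s / 2 \<le> \<bar>z\<bar>\<close> one has min(1, |z|) at most (2/s) min(z^2,
  1). This crude bound serves when \<open>s\<close> is bounded away from 0.\<close>

lemma tail_le:
  assumes s: "0 < s" "s \<le> 1"
  shows "tail s \<le> 2 * C\<^sub>1 / s"
proof -
  have "tail s \<le> (LINT z|lebesgue. 2 / s * (min (\<bar>z\<bar>\<^sup>2) 1 * c z))"
    unfolding tail_def set_lebesgue_integral_def
  proof (intro integral_mono integrable_mult_right integrable_min_sq_c)
    show "integrable lebesgue (\<lambda>z. indicat_real {z. s / 2 \<le> \<bar>z\<bar>} z *\<^sub>R (min 1 \<bar>z\<bar> * c z))"
      using set_integrable_tail[OF s(1)] by (simp add: set_integrable_def)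
    fix z :: real
    show "indicat_real {z. s / 2 \<le> \<bar>z\<bar>} z *\<^sub>R (min 1 \<bar>z\<bar> * c z) \<le> 2 / s * (min (\<bar>z\<bar>\<^sup>2) 1 * c z)"
    proof (cases "s / 2 \<le> \<bar>z\<bar>")
      case True
      then have c: "0 \<le> c z" using c_nonneg[of z] s by fastforce
      have "min 1 \<bar>z\<bar> \<le> 2 / s * min (\<bar>z\<bar>\<^sup>2) 1"
      proof (cases "\<bar>z\<bar> \<le> 1")
        case le: True
        then have "\<bar>z\<bar>\<^sup>2 \<le> 1" by (simp add: abs_square_le_1)
        moreover have "s / 2 * \<bar>z\<bar> \<le> \<bar>z\<bar>\<^sup>2" using mult_right_mono[OF True abs_ge_zero[of z]] by (simp only: power2_eq_square)
        ultimately show ?thesis using le s by (simp add: min_def field_simps)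
      next
        case False
        then have "1 \<le> \<bar>z\<bar>\<^sup>2" by (metis abs_square_less_1 power2_abs less_imp_le not_le)
        then show ?thesis using False s by (simp add: min_def field_simps)
      qed
      then have "min 1 \<bar>z\<bar> * c z \<le> 2 / s * min (\<bar>z\<bar>\<^sup>2) 1 * c z" using c by (rule mult_right_mono)
      then show ?thesis using True by (simp add: mult.assoc)
    next
      case False
      then show ?thesis using min_sq_c_nonneg[of z] s by simp
    qed
  qed
  also have "\<dots> = 2 / s * (LINT z|lebesgue. min (\<bar>z\<bar>\<^sup>2) 1 * c z)" by simp
  also have "\<dots> \<le> 2 / s * C\<^sub>1" using integral_min_sq_c s by (intro mult_left_mono) auto
  finally show ?thesis by simp
qed

text \<open>For |z| at most 1 the integrand is at most a multiple of |z| powr (\<theta> - \<gamma>)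
  times |z| powr (-\<theta>). The first factor is largest at |z| = s/2 because \<theta> < \<gamma>,
  and the second is integrable because \<theta> < 1. The result has the same order in
  \<open>s\<close> as the gain.\<close>

lemma tail_le_powr:
  assumes "0 < \<theta>" "\<theta> < 1" "\<theta> < \<gamma>"
  obtains K where "K > 0" "\<And>s. 0 < s \<Longrightarrow> s \<le> 1 \<Longrightarrow> tail s \<le> K * s powr (\<theta> - \<gamma>)"
proof -
  have "(\<lambda>z::real. z powr (- \<theta>)) integrable_on {0..1}"
    by (rule has_integral_integrable, rule has_integral_powr_from_0) (use assms in auto)
  then have i1: "(\<lambda>z::real. \<bar>z\<bar> powr (- \<theta>)) integrable_on {0..1}"
    by (rule integrable_eq) simp
  then have "(\<lambda>z::real. \<bar>- z\<bar> powr (- \<theta>)) integrable_on {-1..-0}"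
    by (rule Henstock_Kurzweil_Integration.integrable_reflect_real[where f = "\<lambda>z. \<bar>z\<bar> powr (- \<theta>)" and a = 0 and b = 1, THEN iffD2])
  then have "(\<lambda>z::real. \<bar>z\<bar> powr (- \<theta>)) integrable_on {-1..0}"
    by (simp only: abs_minus_cancel minus_zero)
  then have "(\<lambda>z::real. \<bar>z\<bar> powr (- \<theta>)) integrable_on {-1..1}"
    using i1 by (intro Henstock_Kurzweil_Integration.integrable_combine[of "-1" 0 1]) auto
  then have i2: "set_integrable lebesgue {-1..1} (\<lambda>z::real. \<bar>z\<bar> powr (- \<theta>))"
    by (intro nonnegative_absolutely_integrable_1) auto
  define I where "I = (LINT z:{-1..1}|lebesgue. \<bar>z\<bar> powr (- \<theta>))"
  have "I \<ge> 0" unfolding I_def set_lebesgue_integral_def by (intro Bochner_Integration.integral_nonneg) auto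
  define K where "K = C\<^sub>1 + C\<^sub>3 * (1 / 2) powr (\<theta> - \<gamma>) * I"
  show ?thesis
  proof
    show "K > 0" unfolding K_def using pos \<open>I \<ge> 0\<close> by (intro add_pos_nonneg) auto
    fix s :: real assume s: "0 < s" "s \<le> 1"
    define a where "a = C\<^sub>3 * (s / 2) powr (\<theta> - \<gamma>)"
    have a: "0 \<le> a" using pos by (simp add: a_def)
    have "tail s \<le> (LINT z|lebesgue. min (\<bar>z\<bar>\<^sup>2) 1 * c z + a * (indicat_real {-1..1} z *\<^sub>R \<bar>z\<bar> powr (- \<theta>)))"
      unfolding tail_def set_lebesgue_integral_def
    proof (intro integral_mono integrable_mult_right integrable_min_sq_c Bochner_Integration.integrable_add)
      show "integrable lebesgue (\<lambda>z. indicat_real {-1..1} z *\<^sub>R \<bar>z\<bar> powr (- \<theta>))"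
        using i2 by (simp add: set_integrable_def)
      show "integrable lebesgue (\<lambda>z. indicat_real {z. s / 2 \<le> \<bar>z\<bar>} z *\<^sub>R (min 1 \<bar>z\<bar> * c z))"
        using set_integrable_tail[OF s(1)] by (simp add: set_integrable_def)
      fix z :: real
      show "indicat_real {z. s / 2 \<le> \<bar>z\<bar>} z *\<^sub>R (min 1 \<bar>z\<bar> * c z)
        \<le> min (\<bar>z\<bar>\<^sup>2) 1 * c z + a * (indicat_real {-1..1} z *\<^sub>R \<bar>z\<bar> powr (- \<theta>))"
      proof -
        have nn: "0 \<le> a * (indicat_real {-1..1} z *\<^sub>R \<bar>z\<bar> powr (- \<theta>))" using a by simp
        consider "\<bar>z\<bar> < s / 2" | "s / 2 \<le> \<bar>z\<bar>" "\<bar>z\<bar> \<le> 1" | "\<bar>z\<bar> > 1" "s / 2 \<le> \<bar>z\<bar>" using s by linarith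
        then show ?thesis
        proof cases
          case 1
          then show ?thesis using nn min_sq_c_nonneg[of z] by (simp del: scaleR_conv_of_real)
        next
          case 2
          then have z: "0 < \<bar>z\<bar>" using s by linarith
          have "\<bar>z\<bar> * c z \<le> \<bar>z\<bar> * (C\<^sub>3 / \<bar>z\<bar> powr (1 + \<gamma>))"
            using c_bounds(2)[of z] z 2 by (intro mult_left_mono) auto
          also have "\<dots> = C\<^sub>3 * \<bar>z\<bar> powr (\<theta> - \<gamma>) * \<bar>z\<bar> powr (- \<theta>)"
            using z by (simp add: powr_add powr_diff powr_minus field_simps)
          also have "\<dots> \<le> a * \<bar>z\<bar> powr (- \<theta>)"
            unfolding a_def using 2 s assms pos by (intro mult_right_mono mult_left_mono powr_mono2') auto
          finally show ?thesis using 2 min_sq_c_nonneg[of z] by (simp add: abs_le_iff)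
        next
          case 3
          then have "1 < \<bar>z\<bar>\<^sup>2" by (metis abs_square_le_1 power2_abs not_le)
          then show ?thesis using 3 nn by (simp add: min_def)
        qed
      qed
    qed
    also have "\<dots> = (LINT z|lebesgue. min (\<bar>z\<bar>\<^sup>2) 1 * c z) + a * I"
      using i2 integrable_min_sq_c unfolding I_def set_lebesgue_integral_def set_integrable_def
      by (subst Bochner_Integration.integral_add) auto
    also have "\<dots> \<le> C\<^sub>1 * s powr (\<theta> - \<gamma>) + a * I"
    proof -
      have "1 \<le> s powr (\<theta> - \<gamma>)" using powr_mono'[of "\<theta> - \<gamma>" 0 s] s assms by simp
      then have "C\<^sub>1 * 1 \<le> C\<^sub>1 * s powr (\<theta> - \<gamma>)" using pos by (intro mult_left_mono) auto
      then show ?thesis using integral_min_sq_c by simp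
    qed
    also have "\<dots> = K * s powr (\<theta> - \<gamma>)"
      using s by (simp add: a_def K_def powr_divide powr_one_eq_one algebra_simps)
    finally show "tail s \<le> K * s powr (\<theta> - \<gamma>)" .
  qed
qed

text \<open>The compensators carry the same \<open>p\<close> and cancel in the difference. The jumps
  between \<open>s / 4\<close> and \<open>s / 2\<close> have total length \<open>s / 2\<close> and
  density at least \<open>C\<^sub>2 * (s / 2) powr (- 1 - \<gamma>)\<close>, so a decrease of
  \<open>m\<close> there integrates to order s powr (-\<gamma>).\<close>

lemma far_integral_diff_le:
  assumes s: "0 < s" "s \<le> 1" and u: "u \<in> borel_measurable borel" and bdd: "\<And>x. \<bar>u x\<bar> \<le> M"
    and "0 \<le> m"
    and near: "\<And>z. s / 4 \<le> \<bar>z\<bar> \<Longrightarrow> \<bar>z\<bar> \<le> s / 2 \<Longrightarrow> (u (x + z) - u x) - (u (y + z) - u y) \<le> - m"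
    and far: "\<And>z. s / 2 \<le> \<bar>z\<bar> \<Longrightarrow> (u (x + z) - u x) - (u (y + z) - u y) \<le> 2 * b * min 1 \<bar>z\<bar>"
  shows "far_integral c u x p (s / 4) - far_integral c u y p (s / 4) \<le> - (m * C\<^sub>2 * s powr (- \<gamma>)) + 2 * b * tail s"
proof -
  define S where "S = {z::real. s / 4 \<le> \<bar>z\<bar>}"
  define f where "f = (\<lambda>x z. u (x + z) - u x - of_bool (\<bar>z\<bar> \<le> 1) * (z * p))"
  have f_meas: "f x \<in> borel_measurable borel" for x
    unfolding f_def of_bool_def using u by measurable
  have f_bdd: "\<bar>f x z\<bar> \<le> 2 * M + \<bar>p\<bar>" for x z
  proof -
    have "\<bar>of_bool (\<bar>z\<bar> \<le> 1) * (z * p)\<bar> \<le> 1 * \<bar>p\<bar>"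
      by (auto simp: abs_mult intro!: mult_left_le_one_le)
    then show ?thesis using bdd[of x] bdd[of "x + z"] unfolding f_def by linarith
  qed
  have f_int: "set_integrable lebesgue S (\<lambda>z. f x z * c z)" for x
    unfolding S_def using s f_meas f_bdd by (intro set_integrable_far) auto
  \<comment> \<open>The points with |z| = s/2 are left out, so that \<open>A\<close> is disjoint
    from the region of the tail and each \<open>z\<close> is charged to one estimate only.\<close>
  define A where "A = {- (s / 2)<..- (s / 4)} \<union> {s / 4..<s / 2}"
  define d where "d = m * C\<^sub>2 * (s / 2) powr (- 1 - \<gamma>)"
  have A: "A \<in> sets lebesgue" unfolding A_def by auto
  have emA: "emeasure lebesgue A = ennreal (s / 2)"
  proof -
    have "emeasure lebesgue A = emeasure lebesgue {- (s / 2)<..- (s / 4)} + emeasure lebesgue {s / 4..<s / 2}"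
      unfolding A_def using s by (intro plus_emeasure[symmetric]) auto
    also have "\<dots> = ennreal (s / 4) + ennreal (s / 4)" using s by (simp add: emeasure_completion)
    finally show ?thesis using s by (simp flip: ennreal_plus)
  qed
  have intA: "integrable lebesgue (\<lambda>z. d * indicat_real A z)"
    using A emA by (intro integrable_mult_right integrable_real_indicator) auto
  have intT: "integrable lebesgue (\<lambda>z. indicat_real {z. s / 2 \<le> \<bar>z\<bar>} z *\<^sub>R (min 1 \<bar>z\<bar> * c z))"
    using set_integrable_tail[OF s(1)] by (simp add: set_integrable_def)
  have intD: "set_integrable lebesgue S (\<lambda>z. f x z * c z - f y z * c z)"
    using f_int by (intro set_integral_diff)
  have "far_integral c u x p (s / 4) - far_integral c u y p (s / 4) = (LINT z:S|lebesgue. f x z * c z - f y z * c z)"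
    using set_integral_diff(2)[OF f_int f_int, of x y] by (simp add: far_integral_def S_def f_def)
  also have "\<dots> \<le> (LINT z|lebesgue. - (d * indicat_real A z) +
      2 * b * (indicat_real {z. s / 2 \<le> \<bar>z\<bar>} z *\<^sub>R (min 1 \<bar>z\<bar> * c z)))"
    unfolding set_lebesgue_integral_def
  proof (intro integral_mono Bochner_Integration.integrable_add Bochner_Integration.integrable_minus
      intA integrable_mult_right intT)
    show "integrable lebesgue (\<lambda>z. indicat_real S z *\<^sub>R (f x z * c z - f y z * c z))"
      using intD by (simp add: set_integrable_def)
    fix z :: real
    define D where "D = (u (x + z) - u x) - (u (y + z) - u y)"
    have fD: "f x z * c z - f y z * c z = D * c z" by (simp add: f_def D_def algebra_simps)
    consider "\<bar>z\<bar> < s / 4" | "s / 4 \<le> \<bar>z\<bar>" "\<bar>z\<bar> < s / 2" | "s / 2 \<le> \<bar>z\<bar>" by linarith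
    then show "indicat_real S z *\<^sub>R (f x z * c z - f y z * c z) \<le> - (d * indicat_real A z) +
      2 * b * (indicat_real {z. s / 2 \<le> \<bar>z\<bar>} z *\<^sub>R (min 1 \<bar>z\<bar> * c z))"
    proof cases
      case 1
      then have "z \<notin> A" "z \<notin> S" using s by (auto simp: A_def S_def)
      then show ?thesis using 1 by simp
    next
      case 2
      then have "z \<in> A" "z \<in> S" using s by (auto simp: A_def S_def)
      have z: "0 < \<bar>z\<bar>" using 2 s by linarith
      have "C\<^sub>2 * (s / 2) powr (- 1 - \<gamma>) \<le> C\<^sub>2 * \<bar>z\<bar> powr (- 1 - \<gamma>)"
        using 2 z pos by (intro mult_left_mono powr_mono2') auto
      also have "\<dots> = C\<^sub>2 / \<bar>z\<bar> powr (1 + \<gamma>)"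
        using powr_minus_divide[of "\<bar>z\<bar>" "1 + \<gamma>"] by simp
      also have "\<dots> \<le> c z" using c_bounds(1)[of z] z 2 s by simp
      finally have c: "C\<^sub>2 * (s / 2) powr (- 1 - \<gamma>) \<le> c z" .
      have "D * c z \<le> - m * c z"
        using near[of z] 2 c_nonneg[of z] z unfolding D_def by (intro mult_right_mono) auto
      also have "\<dots> \<le> - d" unfolding d_def using mult_left_mono[OF c \<open>0 \<le> m\<close>] by (simp add: mult.assoc)
      finally show ?thesis using \<open>z \<in> A\<close> \<open>z \<in> S\<close> 2 by (simp add: fD)
    next
      case 3
      then have "z \<notin> A" "z \<in> S" using s by (auto simp: A_def S_def)
      have "D * c z \<le> 2 * b * min 1 \<bar>z\<bar> * c z"
        using far[of z] 3 c_nonneg[of z] s unfolding D_def by (intro mult_right_mono) auto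
      then show ?thesis using \<open>z \<notin> A\<close> \<open>z \<in> S\<close> 3 by (simp add: fD mult.assoc)
    qed
  qed
  also have "\<dots> = - (d * (s / 2)) + 2 * b * tail s"
    using intA intT A emA s
    by (subst Bochner_Integration.integral_add) (auto simp: tail_def set_lebesgue_integral_def measure_def)
  also have "d * (s / 2) = m * C\<^sub>2 * (s / 2) powr (- \<gamma>)"
  proof -
    have "(s / 2) powr (- 1 - \<gamma>) * (s / 2) = (s / 2) powr (- 1 - \<gamma>) * (s / 2) powr 1" using s by simp
    also have "\<dots> = (s / 2) powr (- \<gamma>)" by (subst powr_add[symmetric]) simp
    finally show ?thesis by (simp add: d_def mult.assoc)
  qed
  also have "- (m * C\<^sub>2 * (s / 2) powr (- \<gamma>)) \<le> - (m * C\<^sub>2 * s powr (- \<gamma>))"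
  proof -
    have "s powr (- \<gamma>) \<le> (s / 2) powr (- \<gamma>)" using s pos by (intro powr_mono2') auto
    then show ?thesis using pos \<open>0 \<le> m\<close> by (simp add: mult_left_mono)
  qed
  finally show ?thesis by simp
qed

end

section \<open>The Hoelder estimate\<close>

context jump_kernel
begin

text \<open>\<open>K\<close> is fixed before the penalty size and may depend on \<open>v\<close> and
  \<open>T\<close>, since it will influence only \<open>b\<close> and not the Hoelder constant. If
  \<open>v\<close> is uniformly continuous, an oscillation of at least \<open>T\<close> keeps
  \<open>x - y\<close> above some \<open>d\<close>, where the crude tail bound is enough.\<close>

lemma tail_le_at_oscillation:
  fixes v :: "real \<Rightarrow> real"
  assumes \<theta>: "0 < \<theta>" "\<theta> < 1" and "0 < T"
    and uc: "uniformly_continuous_on UNIV v \<or> \<theta> < \<gamma>"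
  obtains K where "K > 0"
    "\<And>x y. y < x \<Longrightarrow> x - y \<le> 1 \<Longrightarrow> T \<le> v x - v y \<Longrightarrow> tail (x - y) \<le> K * (x - y) powr (\<theta> - \<gamma>)"
  using uc
proof
  assume "\<theta> < \<gamma>"
  then obtain K where "K > 0" "\<And>s. 0 < s \<Longrightarrow> s \<le> 1 \<Longrightarrow> tail s \<le> K * s powr (\<theta> - \<gamma>)"
    using tail_le_powr \<theta> by blast
  then show ?thesis by (intro that[of K]) auto
next
  assume "uniformly_continuous_on UNIV v"
  with \<open>0 < T\<close> have "\<exists>d>0. \<forall>x y. dist y x < d \<longrightarrow> dist (v y) (v x) < T"
    by (simp add: uniformly_continuous_on_def)
  then obtain d where d: "d > 0" "\<And>x y. dist y x < d \<Longrightarrow> dist (v y) (v x) < T" by blast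
  show ?thesis
  proof (rule that[of "2 * C\<^sub>1 / (d * d)"])
    show "0 < 2 * C\<^sub>1 / (d * d)" using pos d by simp
    fix x y :: real assume xy: "y < x" "x - y \<le> 1" "T \<le> v x - v y"
    define s where "s = x - y"
    have s: "0 < s" "s \<le> 1" using xy by (auto simp: s_def)
    have "d \<le> s"
      using d(2)[of x y] xy by (force simp: dist_real_def s_def)
    have "tail s \<le> 2 * C\<^sub>1 / s" using tail_le s by blast
    also have "\<dots> \<le> 2 * C\<^sub>1 / d" using \<open>d \<le> s\<close> d pos by (intro divide_left_mono) auto
    also have "\<dots> = 2 * C\<^sub>1 / (d * d) * d" using d by simp
    also have "\<dots> \<le> 2 * C\<^sub>1 / (d * d) * s powr (\<theta> - \<gamma>)"
    proof (intro mult_left_mono)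
      \<comment> \<open>The exponent \<theta> - \<gamma> is below 1 and \<open>s \<le> 1\<close>;
        this also covers \<theta> \<ge> \<gamma>, where the right-hand side may be small.\<close>
      have "s powr 1 \<le> s powr (\<theta> - \<gamma>)" using s \<theta> pos by (intro powr_mono') auto
      then show "d \<le> s powr (\<theta> - \<gamma>)" using \<open>d \<le> s\<close> s by simp
    qed (use pos d in auto)
    finally show "tail (x - y) \<le> 2 * C\<^sub>1 / (d * d) * (x - y) powr (\<theta> - \<gamma>)" by (simp add: s_def)
  qed
qed

text \<open>With U = s powr (\<theta> - \<gamma>) the nonlocal gain is k C U. The penalty, the
  variation of \<open>H\<close> and the variation of \<open>g\<close> each cost at most a quarter of
  it, which contradicts the two equations.\<close>

lemma one_sided_holder_bound:
  fixes v :: "real \<Rightarrow> real"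
  assumes sub: "line_subsolution H c g v" and super: "line_supersolution H c g v"
    and cont: "continuous_on UNIV v" and bdd: "\<And>x. \<bar>v x\<bar> \<le> M"
    and uc: "uniformly_continuous_on UNIV v \<or> \<theta> < \<gamma>"
    and \<theta>: "0 < \<theta>" "\<theta> < 1" "\<theta> < \<theta>\<^sub>0 + \<gamma>" and \<theta>\<^sub>0: "0 \<le> \<theta>\<^sub>0" "\<theta>\<^sub>0 \<le> 1"
    and H: "\<And>x y p. \<bar>H x p - H y p\<bar> \<le> w \<bar>x - y\<bar> * \<bar>p\<bar> powr q"
    and g: "\<And>x y. \<bar>g x - g y\<bar> \<le> M * \<bar>x - y\<bar> powr \<theta>\<^sub>0"
    and w: "\<And>t. 0 < t \<Longrightarrow> t \<le> r \<Longrightarrow> w t \<le> W * t powr \<rho>"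
    and params: "1 \<le> q" "0 < W" "0 < \<rho>" "0 < M"
    and k: "k = \<theta> * (1 - \<theta>) / 1024 * C\<^sub>2"
    and C: "0 < C" "2 * M \<le> C" "2 * M \<le> k / 4 * C"
    and small: "\<And>s. 0 < s \<Longrightarrow> s \<le> 1 \<Longrightarrow> C * s powr \<theta> \<le> 2 * M \<Longrightarrow>
      2 * s \<le> r \<and> W * 2 powr \<rho> * (2 * M) powr (q - 1) * s powr (\<rho> + \<gamma> - q) \<le> k / 4"
    and "y1 < x1"
  shows "v x1 - v y1 \<le> C * (x1 - y1) powr \<theta>"
proof (rule ccontr)
  assume neg: "\<not> ?thesis"
  define T where "T = v x1 - v y1 - C * (x1 - y1) powr \<theta>"
  have "T > 0" using neg by (simp add: T_def)
  obtain K where K: "K > 0"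
    "\<And>x y. y < x \<Longrightarrow> x - y \<le> 1 \<Longrightarrow> T \<le> v x - v y \<Longrightarrow> tail (x - y) \<le> K * (x - y) powr (\<theta> - \<gamma>)"
    using tail_le_at_oscillation[OF \<theta>(1,2) \<open>T > 0\<close> uc] by blast
  have "k > 0" unfolding k using \<theta> pos by simp
  \<comment> \<open>The first bound is required for the touching lines; the second makes the penalty
    cost at most a quarter of the gain.\<close>
  define b where "b = min (\<theta> * (1 - \<theta>) / 8 * C / 128) (k * C / (8 * K))"
  have b: "0 < b" "b \<le> \<theta> * (1 - \<theta>) / 8 * C / 128"
    using \<theta> C K \<open>k > 0\<close> by (auto simp: b_def)
  have bK: "2 * b * K \<le> k / 4 * C"
  proof -
    have "b \<le> k * C / (8 * K)" by (simp add: b_def)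
    then show ?thesis using K(1) by (simp add: field_simps)
  qed
  obtain x y where xy: "y < x" "x - y \<le> 1" "T \<le> v x - v y - C * (x - y) powr \<theta>"
    and max: "\<And>x' y'. y' \<le> x' \<Longrightarrow>
      v x' - v y' - C * (x' - y') powr \<theta> \<le> v x - v y - C * (x - y) powr \<theta> + b * min 1 \<bar>x' - x\<bar>"
    by (rule penalised_maximum[OF cont bdd C(1,2) b(1) \<theta>(1) \<open>y1 < x1\<close> T_def \<open>T > 0\<close>]) (rule that)
  define s where "s = x - y"
  have s: "s = x - y" "0 < s" "s \<le> 1" using xy by (auto simp: s_def)
  have C0: "0 \<le> C * s powr \<theta>" using C by simp
  \<comment> \<open>The first inequality feeds the tail estimate. The second forces \<open>s\<close>
    to be small when \<open>C\<close> is large and later absorbs powers of \<open>C\<close>.\<close>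
  have osc: "T \<le> v x - v y" "C * s powr \<theta> \<le> 2 * M"
    using xy(3) C0 \<open>T > 0\<close> bdd[of x] bdd[of y] unfolding s_def by linarith+
  define p where "p = C * \<theta> * s powr (\<theta> - 1)"
  obtain x' where x': "\<bar>x' - x\<bar> \<le> s / 8"
    and up: "\<And>z. \<bar>z\<bar> \<le> s / 4 \<Longrightarrow> v (x' + z) \<le> v x' + p * z"
    and low: "\<And>z. \<bar>z\<bar> \<le> s / 4 \<Longrightarrow> v y + p * z \<le> v (y + z)"
    and near: "\<And>z. s / 4 \<le> \<bar>z\<bar> \<Longrightarrow> \<bar>z\<bar> \<le> s / 2 \<Longrightarrow>
      (v (x' + z) - v x') - (v (y + z) - v y) \<le> - (\<theta> * (1 - \<theta>) / 8 * C / 128 * s powr \<theta>)"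
    and far: "\<And>z. s / 2 \<le> \<bar>z\<bar> \<Longrightarrow> (v (x' + z) - v x') - (v (y + z) - v y) \<le> 2 * b * min 1 \<bar>z\<bar>"
    by (rule touching_lines[OF cont \<theta>(1,2) C(1) less_imp_le[OF b(1)] b(2) s max, folded p_def], assumption, rule that)
  define U where "U = s powr (\<theta> - \<gamma>)"
  have U: "U > 0" using s(2) by (simp add: U_def)
  have meas: "v \<in> borel_measurable borel" using cont by (rule borel_measurable_continuous_onI)
  define m where "m = \<theta> * (1 - \<theta>) / 8 * C / 128 * s powr \<theta>"
  have m: "0 \<le> m" using \<theta> C by (simp add: m_def)
  have "H x' p - far_integral c v x' p (s / 4) - g x' \<le> 0"
    using sub up s(2) unfolding line_subsolution_def by auto
  moreover have "H y p - far_integral c v y p (s / 4) - g y \<ge> 0"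
    using super low s(2) unfolding line_supersolution_def by auto
  moreover have "far_integral c v x' p (s / 4) - far_integral c v y p (s / 4)
      \<le> - (m * C\<^sub>2 * s powr (- \<gamma>)) + 2 * b * tail s"
    using near far by (intro far_integral_diff_le[OF s(2,3) meas bdd m]) (auto simp: m_def)
  moreover have "m * C\<^sub>2 * s powr (- \<gamma>) = k * C * U"
  proof -
    have "s powr \<theta> * s powr (- \<gamma>) = U" by (simp add: U_def flip: powr_add)
    moreover have "m * C\<^sub>2 * s powr (- \<gamma>) = k * C * (s powr \<theta> * s powr (- \<gamma>))"
      by (simp add: m_def k)
    ultimately show ?thesis by simp
  qed
  moreover have "2 * b * tail s \<le> k / 4 * C * U"
  proof -
    have "tail s \<le> K * U" using K(2)[OF xy(1,2) osc(1)] by (simp add: U_def s_def)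
    then have "2 * b * tail s \<le> 2 * b * (K * U)" using b by (intro mult_left_mono) auto
    also have "\<dots> = 2 * b * K * U" by simp
    also have "\<dots> \<le> k / 4 * C * U" using bK U by (intro mult_right_mono) auto
    finally show ?thesis .
  qed
  moreover define t where "t = \<bar>x' - y\<bar>"
  \<comment> \<open>The shift of at most \<open>s / 8\<close> keeps the contact points apart, so the
    power bound on \<open>w\<close>, which is assumed at positive arguments only, applies to
    \<open>t\<close>.\<close>
  have "0 < x' - y" "x' - y \<le> 2 * s" using x' s(1,2) by linarith+
  then have t: "0 < t" "t \<le> 2 * s" by (auto simp: t_def)
  note sm = small[OF s(2,3) osc(2)]
  have "- (H x' p - H y p) \<le> k / 4 * C * U"
  proof -
    have "w t \<le> W * t powr \<rho>" using w t sm by auto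
    also have "\<dots> \<le> W * (2 * s) powr \<rho>"
      using t params by (intro mult_left_mono powr_mono2) auto
    also have "\<dots> = W * 2 powr \<rho> * s powr \<rho>" using s(2) by (simp add: powr_mult)
    finally have wt: "w t \<le> W * 2 powr \<rho> * s powr \<rho>" .
    have "0 \<le> p" "p \<le> C * s powr (\<theta> - 1)"
    proof -
      have "\<theta> * (C * s powr (\<theta> - 1)) \<le> 1 * (C * s powr (\<theta> - 1))"
        using \<theta> C by (intro mult_right_mono) auto
      then show "p \<le> C * s powr (\<theta> - 1)" by (simp add: p_def mult_ac)
    qed (use \<theta> C in \<open>simp add: p_def\<close>)
    then have "\<bar>p\<bar> powr q \<le> (C * s powr (\<theta> - 1)) powr q"
      using params by (intro powr_mono2) auto
    \<comment> \<open>The gain is only linear in \<open>C\<close>, so just one factor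
      \<open>C\<close> may survive. The other q - 1 powers are grouped as (C s powr \<theta>) powr
      (q - 1), which is bounded through 2M.\<close>
    also have "\<dots> = C * s powr (\<theta> - 1) * (C * s powr (\<theta> - 1)) powr (q - 1)"
      using powr_add[of "C * s powr (\<theta> - 1)" 1 "q - 1"] C by simp
    also have "C * s powr (\<theta> - 1) = C * s powr \<theta> * s powr (- 1)"
      using powr_add[of s \<theta> "- 1"] by simp
    also have "(\<dots>) powr (q - 1) = (C * s powr \<theta>) powr (q - 1) * s powr (1 - q)"
      using powr_mult[of "C * s powr \<theta>" "s powr (- 1)" "q - 1"] C0
      by (simp only: powr_powr[of s "- 1"]) simp
    also have "C * s powr \<theta> * s powr (- 1) * ((C * s powr \<theta>) powr (q - 1) * s powr (1 - q))
        = (C * s powr \<theta>) powr (q - 1) * C * (s powr \<theta> * s powr (- 1) * s powr (1 - q))"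
      by (simp only: mult_ac)
    also have "s powr \<theta> * s powr (- 1) * s powr (1 - q) = s powr (\<theta> - q)"
      by (simp only: powr_add[symmetric]) simp
    also have "(C * s powr \<theta>) powr (q - 1) * C * s powr (\<theta> - q)
        \<le> (2 * M) powr (q - 1) * C * s powr (\<theta> - q)"
      using osc(2) C0 C params by (intro mult_right_mono powr_mono2) auto
    finally have pq: "\<bar>p\<bar> powr q \<le> (2 * M) powr (q - 1) * C * s powr (\<theta> - q)" .
    have "- (H x' p - H y p) \<le> w t * \<bar>p\<bar> powr q" using H[of x' p y] by (simp add: t_def)
    also have "\<dots> \<le> W * 2 powr \<rho> * s powr \<rho> * \<bar>p\<bar> powr q" using wt by (rule mult_right_mono) simp
    also have "\<dots> \<le> W * 2 powr \<rho> * s powr \<rho> * ((2 * M) powr (q - 1) * C * s powr (\<theta> - q))"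
      using pq params by (intro mult_left_mono) auto
    also have "\<dots> = W * 2 powr \<rho> * (2 * M) powr (q - 1) * C * (s powr \<rho> * s powr (\<theta> - q))"
      by (simp add: mult_ac)
    \<comment> \<open>Relative to \<open>U\<close> the loss carries the positive power \<rho> +
      \<gamma> - q of \<open>s\<close>, so it is small at small scales.\<close>
    also have "s powr \<rho> * s powr (\<theta> - q) = s powr (\<rho> + \<gamma> - q) * U"
      unfolding U_def powr_add[symmetric] by simp
    also have "W * 2 powr \<rho> * (2 * M) powr (q - 1) * C * (s powr (\<rho> + \<gamma> - q) * U)
        = W * 2 powr \<rho> * (2 * M) powr (q - 1) * s powr (\<rho> + \<gamma> - q) * (C * U)"
      by (simp add: mult_ac)
    also have "\<dots> \<le> k / 4 * (C * U)"
      using sm C U by (intro mult_right_mono) auto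
    finally show ?thesis by simp
  qed
  moreover have "g x' - g y \<le> k / 4 * C * U"
  proof -
    have "g x' - g y \<le> M * t powr \<theta>\<^sub>0" using g[of x' y] by (simp add: t_def)
    also have "\<dots> \<le> M * (2 * s) powr \<theta>\<^sub>0"
      using t params \<theta>\<^sub>0 by (intro mult_left_mono powr_mono2) auto
    also have "\<dots> = M * (2 powr \<theta>\<^sub>0 * s powr \<theta>\<^sub>0)" using s(2) by (simp add: powr_mult)
    also have "\<dots> \<le> M * (2 * U)"
    proof (intro mult_left_mono mult_mono)
      show "2 powr \<theta>\<^sub>0 \<le> (2::real)" using powr_mono[of \<theta>\<^sub>0 1 2] \<theta>\<^sub>0 by simp
      \<comment> \<open>This is where \<theta> < \<open>\<theta>\<^sub>0 + \<gamma>\<close> enters,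
        together with \<open>s \<le> 1\<close>.\<close>
      show "s powr \<theta>\<^sub>0 \<le> U" unfolding U_def using s(2,3) \<theta> by (intro powr_mono') auto
    qed (use params in auto)
    also have "\<dots> = 2 * M * U" by simp
    also have "\<dots> \<le> k / 4 * C * U" using C(3) U by (intro mult_right_mono) auto
    finally show ?thesis .
  qed
  moreover have "0 < k * C * U" using \<open>k > 0\<close> C U by simp
  ultimately show False by linarith
qed

end

section \<open>A constant uniform over all admissible equations, and the bootstrap in the
  exponent\<close>

lemma small_scale_exists:
  fixes \<theta> \<sigma> :: real
  assumes "0 < \<theta>" "0 < \<sigma>" "0 < r" "0 < A" "0 < \<epsilon>" "0 < M"
  obtains C where "C > B"
    "\<And>s. 0 < s \<Longrightarrow> C * s powr \<theta> \<le> M \<Longrightarrow> 2 * s \<le> r \<and> A * s powr \<sigma> \<le> \<epsilon>"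
proof -
  \<comment> \<open>Both requirements on \<open>s\<close> hold up to the threshold
    \<open>s0\<close>. Taking \<open>C\<close> above M / s0 powr \<theta> makes C s powr \<theta>
    \<le> M imply \<open>s \<le> s0\<close>.\<close>
  define s0 where "s0 = min (r / 2) ((\<epsilon> / A) powr (1 / \<sigma>))"
  have s0: "0 < s0" using assms by (simp add: s0_def)
  show ?thesis
  proof (rule that)
    have "0 \<le> M / s0 powr \<theta>" using assms by simp
    then show "B < max 0 B + 1 + M / s0 powr \<theta>" by linarith
    fix s assume s: "0 < s" "(max 0 B + 1 + M / s0 powr \<theta>) * s powr \<theta> \<le> M"
    have "M / s0 powr \<theta> * s powr \<theta> \<le> (max 0 B + 1 + M / s0 powr \<theta>) * s powr \<theta>"
      by (intro mult_right_mono) auto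
    with s have "M / s0 powr \<theta> * s powr \<theta> \<le> M" by linarith
    then have "s powr \<theta> \<le> s0 powr \<theta>" using assms s0 by (simp add: field_simps)
    then have le: "s \<le> s0" using powr_less_mono2[of \<theta> s0 s] assms s0 by force
    have "s powr \<sigma> \<le> ((\<epsilon> / A) powr (1 / \<sigma>)) powr \<sigma>"
      using le s assms by (intro powr_mono2) (auto simp: s0_def)
    also have "\<dots> = \<epsilon> / A" using assms by (simp add: powr_powr)
    finally show "2 * s \<le> r \<and> A * s powr \<sigma> \<le> \<epsilon>"
      using le assms by (auto simp: s0_def field_simps)
  qed
qed

text \<open>Kernel, source and \<open>H\<close> are quantified existentially inside the set, so a
  constant chosen for the whole set cannot depend on them or on \<open>v\<close>. The set is closed
  under negation.\<close>

definition line_solutions ::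
    "real \<Rightarrow> real \<Rightarrow> real \<Rightarrow> real \<Rightarrow> real \<Rightarrow> real \<Rightarrow> real \<Rightarrow> (real \<Rightarrow> real) \<Rightarrow> (real \<Rightarrow> real) set" where
  "line_solutions C\<^sub>1 C\<^sub>2 C\<^sub>3 \<gamma> \<theta>\<^sub>0 M q w = {v. continuous_on UNIV v \<and> (\<forall>x. \<bar>v x\<bar> \<le> M) \<and>
     (\<exists>c g H. jump_kernel c C\<^sub>1 C\<^sub>2 C\<^sub>3 \<gamma> \<and> line_subsolution H c g v \<and> line_supersolution H c g v \<and>
       (\<forall>x y p. \<bar>H x p - H y p\<bar> \<le> w \<bar>x - y\<bar> * \<bar>p\<bar> powr q) \<and>
       (\<forall>x y. \<bar>g x - g y\<bar> \<le> M * \<bar>x - y\<bar> powr \<theta>\<^sub>0))}"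

lemma line_solutions_uminus:
  assumes "v \<in> line_solutions C\<^sub>1 C\<^sub>2 C\<^sub>3 \<gamma> \<theta>\<^sub>0 M q w"
  shows "(\<lambda>x. - v x) \<in> line_solutions C\<^sub>1 C\<^sub>2 C\<^sub>3 \<gamma> \<theta>\<^sub>0 M q w"
proof -
  obtain c g H where v: "continuous_on UNIV v" "\<forall>x. \<bar>v x\<bar> \<le> M"
      "jump_kernel c C\<^sub>1 C\<^sub>2 C\<^sub>3 \<gamma>" "line_subsolution H c g v" "line_supersolution H c g v"
    and H: "\<forall>x y p. \<bar>H x p - H y p\<bar> \<le> w \<bar>x - y\<bar> * \<bar>p\<bar> powr q"
    and g: "\<forall>x y. \<bar>g x - g y\<bar> \<le> M * \<bar>x - y\<bar> powr \<theta>\<^sub>0"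
    using assms unfolding line_solutions_def by blast
  have "\<bar>- H x (- p) - - H y (- p)\<bar> \<le> w \<bar>x - y\<bar> * \<bar>p\<bar> powr q" for x y p
    using H[rule_format, of x "- p" y] by (simp add: abs_minus_commute)
  moreover have "\<bar>- g x - - g y\<bar> \<le> M * \<bar>x - y\<bar> powr \<theta>\<^sub>0" for x y
    using g[rule_format, of x y] by (simp add: abs_minus_commute)
  ultimately show ?thesis
    unfolding line_solutions_def mem_Collect_eq
    using v line_subsolution_uminus[OF v(5)] line_supersolution_uminus[OF v(4)]
    by (intro conjI exI[of _ c] exI[of _ "\<lambda>x. - g x"] exI[of _ "\<lambda>x p. - H x (- p)"])
      (auto intro: continuous_on_minus)
qed

lemma holder_bound_exists:
  fixes \<gamma> \<theta>\<^sub>0 M C\<^sub>1 C\<^sub>2 C\<^sub>3 q W r \<rho> \<theta> :: real and w :: "real \<Rightarrow> real"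
  assumes \<theta>: "0 < \<theta>" "\<theta> < 1" "\<theta> < \<theta>\<^sub>0 + \<gamma>" and \<theta>\<^sub>0: "0 \<le> \<theta>\<^sub>0" "\<theta>\<^sub>0 \<le> 1"
    and w: "\<And>t. 0 < t \<Longrightarrow> t \<le> r \<Longrightarrow> w t \<le> W * t powr \<rho>"
    and params: "0 < C\<^sub>2" "0 < r" "1 \<le> q" "0 < W" "0 < \<rho>" "0 < M" "q < \<rho> + \<gamma>"
  shows "\<exists>C>0. \<forall>v \<in> line_solutions C\<^sub>1 C\<^sub>2 C\<^sub>3 \<gamma> \<theta>\<^sub>0 M q w.
    uniformly_continuous_on UNIV v \<or> \<theta> < \<gamma> \<longrightarrow> (\<forall>x y. \<bar>v x - v y\<bar> \<le> C * \<bar>x - y\<bar> powr \<theta>)"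
proof -
  define k where "k = \<theta> * (1 - \<theta>) / 1024 * C\<^sub>2"
  have k: "0 < k" using \<theta> params by (simp add: k_def)
  \<comment> \<open>The threshold 2M confines the doubled maximum to separations at most 1; 8M / k
    makes the cost of \<open>g\<close> at most a quarter of the gain.\<close>
  obtain C where C: "C > max (2 * M) (8 * M / k)"
    and small: "\<And>s. 0 < s \<Longrightarrow> C * s powr \<theta> \<le> 2 * M \<Longrightarrow>
      2 * s \<le> r \<and> W * 2 powr \<rho> * (2 * M) powr (q - 1) * s powr (\<rho> + \<gamma> - q) \<le> k / 4"
    using small_scale_exists[of \<theta> "\<rho> + \<gamma> - q" r "W * 2 powr \<rho> * (2 * M) powr (q - 1)" "k / 4" "2 * M"
        "max (2 * M) (8 * M / k)"] \<theta> params k by auto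
  have C': "0 < C" "2 * M \<le> C" "2 * M \<le> k / 4 * C"
    using C params k by (auto simp: field_simps)
  have one_sided: "v x - v y \<le> C * (x - y) powr \<theta>"
    if v: "v \<in> line_solutions C\<^sub>1 C\<^sub>2 C\<^sub>3 \<gamma> \<theta>\<^sub>0 M q w" and uc: "uniformly_continuous_on UNIV v \<or> \<theta> < \<gamma>"
      and "y < x" for v x y
  proof -
    obtain c g H where cont: "continuous_on UNIV v" and bdd: "\<forall>x. \<bar>v x\<bar> \<le> M"
      and kernel: "jump_kernel c C\<^sub>1 C\<^sub>2 C\<^sub>3 \<gamma>"
      and sub: "line_subsolution H c g v" and super: "line_supersolution H c g v"
      and H: "\<forall>x y p. \<bar>H x p - H y p\<bar> \<le> w \<bar>x - y\<bar> * \<bar>p\<bar> powr q"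
      and g: "\<forall>x y. \<bar>g x - g y\<bar> \<le> M * \<bar>x - y\<bar> powr \<theta>\<^sub>0"
      using v unfolding line_solutions_def by blast
    interpret jump_kernel c C\<^sub>1 C\<^sub>2 C\<^sub>3 \<gamma> by fact
    show ?thesis
      by (rule one_sided_holder_bound[OF sub super cont bdd[rule_format] uc \<theta> \<theta>\<^sub>0 H[rule_format]
            g[rule_format] w params(3-6) k_def C' small \<open>y < x\<close>])
  qed
  show ?thesis
  proof (intro exI[of _ C] conjI ballI impI allI C'(1))
    fix v x y
    assume v: "v \<in> line_solutions C\<^sub>1 C\<^sub>2 C\<^sub>3 \<gamma> \<theta>\<^sub>0 M q w"
      and uc: "uniformly_continuous_on UNIV v \<or> \<theta> < \<gamma>"
    have uc': "uniformly_continuous_on UNIV (\<lambda>x. - v x) \<or> \<theta> < \<gamma>"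
      using uc by (auto intro: uniformly_continuous_on_minus)
    show "\<bar>v x - v y\<bar> \<le> C * \<bar>x - y\<bar> powr \<theta>"
    proof (cases x y rule: linorder_cases)
      case less
      then show ?thesis
        using one_sided[OF v uc less] one_sided[OF line_solutions_uminus[OF v] uc' less] by simp
    next
      case greater
      then show ?thesis
        using one_sided[OF v uc greater] one_sided[OF line_solutions_uminus[OF v] uc' greater] by simp
    qed simp
  qed
qed

lemma holder_imp_uniformly_continuous:
  fixes v :: "real \<Rightarrow> real"
  assumes "C > 0" "\<theta> > 0" and le: "\<And>x y. \<bar>v x - v y\<bar> \<le> C * \<bar>x - y\<bar> powr \<theta>"
  shows "uniformly_continuous_on UNIV v"
  unfolding uniformly_continuous_on_def
proof (intro allI impI)
  fix e :: real assume e: "0 < e"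
  define d where "d = (e / C) powr (1 / \<theta>)"
  have "dist (v x') (v x) < e" if "dist x' x < d" for x x'
  proof -
    have "\<bar>x' - x\<bar> powr \<theta> < d powr \<theta>"
      using that \<open>\<theta> > 0\<close> by (intro powr_less_mono2) (auto simp: dist_real_def)
    also have "\<dots> = e / C" using assms e by (simp add: d_def powr_powr)
    finally have "C * \<bar>x' - x\<bar> powr \<theta> < e" using \<open>C > 0\<close> by (simp add: field_simps)
    then show ?thesis using le[of x' x] by (simp add: dist_real_def)
  qed
  moreover have "d > 0" using e assms by (simp add: d_def)
  ultimately show "\<exists>d>0. \<forall>x\<in>UNIV. \<forall>x'\<in>UNIV. dist x' x < d \<longrightarrow> dist (v x') (v x) < e" by blast
qed

theorem theorem3p1:
  fixes \<gamma> \<theta>\<^sub>0 M C\<^sub>1 C\<^sub>2 C\<^sub>3 q L \<rho>\<^sub>1 \<rho>\<^sub>2 \<theta> :: real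
    and w \<eta> :: "real \<Rightarrow> real"
  assumes "0 < \<gamma>" "\<gamma> < 2"
    and "0 \<le> \<theta>\<^sub>0" "\<theta>\<^sub>0 \<le> 1"
    and "M > 1"
    and "C\<^sub>1 > 0" "C\<^sub>2 > 0" "C\<^sub>3 > 0"
    and "q \<ge> 1"
    and "\<And>s. s \<ge> 0 \<Longrightarrow> w s \<ge> 0" "\<And>s. s \<ge> 0 \<Longrightarrow> \<eta> s \<ge> 0"
    and "(w \<longlongrightarrow> 0) (at_right 0)" "(\<eta> \<longlongrightarrow> 0) (at_right 0)"
    and "L > 0" "\<rho>\<^sub>1 > 0" "\<rho>\<^sub>2 > 0"
    and "\<exists>l \<le> L. ((\<lambda>s. w s * s powr (- \<rho>\<^sub>1)) \<longlongrightarrow> l) (at_right 0)"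
    and "\<exists>l \<le> L. ((\<lambda>s. \<eta> s * s powr (- \<rho>\<^sub>2)) \<longlongrightarrow> l) (at_right 0)"
    and "\<rho>\<^sub>1 + \<gamma> > q" "\<rho>\<^sub>2 + \<gamma> > 2"
    and "0 < \<theta>" "\<theta> < min 1 (\<theta>\<^sub>0 + \<gamma>)"
  shows "\<exists>C\<^sub>\<theta> > 0. \<forall>(c :: real \<Rightarrow> real) (g :: real \<Rightarrow> real)
            (F :: real \<Rightarrow> real \<Rightarrow> real \<Rightarrow> real) (v :: real \<Rightarrow> real).
      positive_radon_density c \<longrightarrow>
      (\<integral>\<^sup>+z. ennreal (min (\<bar>z\<bar>\<^sup>2) 1 * c z) \<partial>lebesgue) \<le> ennreal C\<^sub>1 \<longrightarrow>
      (\<forall>z. 0 < \<bar>z\<bar> \<and> \<bar>z\<bar> \<le> 1 \<longrightarrow>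
         C\<^sub>2 / \<bar>z\<bar> powr (1 + \<gamma>) \<le> \<bar>c z\<bar> \<and> \<bar>c z\<bar> \<le> C\<^sub>3 / \<bar>z\<bar> powr (1 + \<gamma>)) \<longrightarrow>
      (\<forall>x y. \<bar>g x - g y\<bar> \<le> M * \<bar>x - y\<bar> powr \<theta>\<^sub>0) \<longrightarrow>
      continuous_on UNIV (\<lambda>(x, p, X). F x p X) \<longrightarrow>
      degenerate_elliptic F \<longrightarrow>
      (\<forall>x y p X. \<bar>F x p X - F y p X\<bar> \<le> w \<bar>x - y\<bar> * \<bar>p\<bar> powr q + \<eta> \<bar>x - y\<bar> * \<bar>X\<bar>) \<longrightarrow>
      viscosity_solution F c g v \<longrightarrow>
      bdd_above (range (\<lambda>x. \<bar>v x\<bar>)) \<longrightarrow> (SUP x. \<bar>v x\<bar>) < M \<longrightarrow>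
      (\<forall>x y. \<bar>v x - v y\<bar> \<le> C\<^sub>\<theta> * \<bar>x - y\<bar> powr \<theta>)"
proof -
  obtain l where l: "l \<le> L" "((\<lambda>s. w s * s powr (- \<rho>\<^sub>1)) \<longlongrightarrow> l) (at_right 0)" using assms by blast
  \<comment> \<open>The limit may equal \<open>L\<close>, so a strict bound near 0 requires a larger
    constant such as \<open>L + 1\<close>.\<close>
  have "\<forall>\<^sub>F s in at_right 0. w s * s powr (- \<rho>\<^sub>1) < L + 1"
    using l by (intro order_tendstoD(2)[OF l(2)]) auto
  then obtain r where r: "r > 0" "\<And>s. 0 < s \<Longrightarrow> s < r \<Longrightarrow> w s * s powr (- \<rho>\<^sub>1) < L + 1"
    unfolding eventually_at_right_field by blast
  have w: "w t \<le> (L + 1) * t powr \<rho>\<^sub>1" if "0 < t" "t \<le> r / 2" for t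
    using r(2)[of t] that by (simp add: powr_minus field_simps)
  \<comment> \<open>The auxiliary exponent lies below \<gamma>, so the estimate for it needs no
    prior regularity. It yields uniform continuity, which then admits the exponent \<theta>
    itself.\<close>
  define \<theta>\<^sub>1 where "\<theta>\<^sub>1 = min \<theta> (\<gamma> / 2)"
  have \<theta>\<^sub>1: "0 < \<theta>\<^sub>1" "\<theta>\<^sub>1 < 1" "\<theta>\<^sub>1 < \<theta>\<^sub>0 + \<gamma>" "\<theta>\<^sub>1 < \<gamma>"
    using assms by (auto simp: \<theta>\<^sub>1_def)
  have \<theta>: "0 < \<theta>" "\<theta> < 1" "\<theta> < \<theta>\<^sub>0 + \<gamma>" using assms by auto
  have params: "0 < C\<^sub>2" "0 < r / 2" "1 \<le> q" "0 < L + 1" "0 < \<rho>\<^sub>1" "0 < M" "q < \<rho>\<^sub>1 + \<gamma>"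
    using assms r by auto
  note bound = holder_bound_exists[OF _ _ _ assms(3,4) w params]
  define V where "V = line_solutions C\<^sub>1 C\<^sub>2 C\<^sub>3 \<gamma> \<theta>\<^sub>0 M q w"
  obtain D where D: "D > 0" "\<forall>v\<in>V. uniformly_continuous_on UNIV v \<or> \<theta>\<^sub>1 < \<gamma> \<longrightarrow>
      (\<forall>x y. \<bar>v x - v y\<bar> \<le> D * \<bar>x - y\<bar> powr \<theta>\<^sub>1)"
    using bound[OF \<theta>\<^sub>1(1-3), of C\<^sub>1 C\<^sub>3] unfolding V_def by blast
  \<comment> \<open>\<open>C\<close> is chosen before any solution is fixed and independently of
    \<open>D\<close>: the first estimate contributes uniform continuity only as a qualitative
    fact.\<close>
  obtain C where C: "C > 0" "\<forall>v\<in>V. uniformly_continuous_on UNIV v \<or> \<theta> < \<gamma> \<longrightarrow>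
      (\<forall>x y. \<bar>v x - v y\<bar> \<le> C * \<bar>x - y\<bar> powr \<theta>)"
    using bound[OF \<theta>, of C\<^sub>1 C\<^sub>3] unfolding V_def by blast
  show ?thesis
  proof (intro exI[of _ C] conjI allI impI C(1))
    fix c g :: "real \<Rightarrow> real" and F :: "real \<Rightarrow> real \<Rightarrow> real \<Rightarrow> real" and v :: "real \<Rightarrow> real" and x y :: real
    assume c: "positive_radon_density c"
        "(\<integral>\<^sup>+z. ennreal (min (\<bar>z\<bar>\<^sup>2) 1 * c z) \<partial>lebesgue) \<le> ennreal C\<^sub>1"
        "\<forall>z. 0 < \<bar>z\<bar> \<and> \<bar>z\<bar> \<le> 1 \<longrightarrow>
         C\<^sub>2 / \<bar>z\<bar> powr (1 + \<gamma>) \<le> \<bar>c z\<bar> \<and> \<bar>c z\<bar> \<le> C\<^sub>3 / \<bar>z\<bar> powr (1 + \<gamma>)"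
      and g: "\<forall>x y. \<bar>g x - g y\<bar> \<le> M * \<bar>x - y\<bar> powr \<theta>\<^sub>0"
      and F: "\<forall>x y p X. \<bar>F x p X - F y p X\<bar> \<le> w \<bar>x - y\<bar> * \<bar>p\<bar> powr q + \<eta> \<bar>x - y\<bar> * \<bar>X\<bar>"
      and sol: "viscosity_solution F c g v"
      and bdd: "bdd_above (range (\<lambda>x. \<bar>v x\<bar>))" and sup: "(SUP x. \<bar>v x\<bar>) < M"
    have kernel: "jump_kernel c C\<^sub>1 C\<^sub>2 C\<^sub>3 \<gamma>"
      using c assms by unfold_locales auto
    have sub: "line_subsolution (\<lambda>x p. F x p 0) c g v"
      and super: "line_supersolution (\<lambda>x p. F x p 0) c g v"
      using sol viscosity_subsolution_imp_line_subsolution viscosity_supersolution_imp_line_supersolution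
      unfolding viscosity_solution_def by blast+
    have cont: "continuous_on UNIV v"
      using sol semicontinuous_imp_continuous
      unfolding viscosity_solution_def viscosity_subsolution_def viscosity_supersolution_def by blast
    have vM: "\<bar>v x\<bar> \<le> M" for x
      using cSUP_upper[OF UNIV_I bdd, of x] sup by simp
    \<comment> \<open>At X = 0 the term with \<eta> vanishes, leaving only the modulus
      \<open>w\<close>.\<close>
    have H: "\<bar>F x p 0 - F y p 0\<bar> \<le> w \<bar>x - y\<bar> * \<bar>p\<bar> powr q" for x y p
      using F[rule_format, of x p 0 y] by simp
    have "v \<in> V"
      unfolding V_def line_solutions_def using kernel sub super cont vM H g by blast
    then have "\<bar>v x - v y\<bar> \<le> D * \<bar>x - y\<bar> powr \<theta>\<^sub>1" for x y
      using D(2) \<theta>\<^sub>1(4) by blast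
    then have "uniformly_continuous_on UNIV v"
      by (rule holder_imp_uniformly_continuous[OF D(1) \<theta>\<^sub>1(1)])
    then show "\<bar>v x - v y\<bar> \<le> C * \<bar>x - y\<bar> powr \<theta>"
      using C(2) \<open>v \<in> V\<close> by blast
  qed
qed

end
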